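(* Let $X$ be a finite connected CW complex of dimension $d\ge 1$, and let $\mathcal{L}=\partial\partial^*\colon B_{d-1}(X;\mathbb{R})\to B_{d-1}(X;\mathbb{R})$. For a spanning tree $T$ of $X$ let $\mathcal{L}^T=\partial\partial_T^*\colon B_{d-1}(T;\mathbb{R})\to B_{d-1}(T;\mathbb{R})$ (an isomorphism), and let $\mu_T$ be the square of the covolume of the lattice $B_{d-1}(T;\mathbb{Z})\subset B_{d-1}(T;\mathbb{R})$ with respect to the restriction of the standard inner product of $C_{d-1}(T;\mathbb{R})$. Then $$\det\mathcal{L}=\sum_T\det\mathcal{L}^T=\sum_T\mu_T,$$ where the sums are over all spanning trees $T$ of $X$.
   Context: Notation. $X_k$ is the set of $k$-cells of $X$, $X^{(k)}$ its $k$-skeleton, $C_k(X;A)$ the cellular chain group (free $A$-module on $X_k$), $\partial\colon C_d(X;\mathbb{R})\to C_{d-1}(X;\mathbb{R})$ the cellular boundary, $B_k(X;A)$ the $k$-boundaries; all homology is cellular, and $\beta_k$ denotes the $k$-th Betti number. The standard inner product on $C_k(X;\mathbb{R})$ is the one for which $X_k$ is an orthonormal basis, and $\partial^*$ is the adjoint of $\partial$ with respect to the standard inner products. Spanning tree. A spanning tree for $X$ is a subcomplex $T\subset X$ such that $H_d(T;\mathbb{Z})=0$, $\beta_{d-1}(T)=\beta_{d-1}(X)$, and $X^{(d-1)}\subset T$. For such $T$, $\partial_T^*\colon C_{d-1}(T;\mathbb{R})\to C_d(T;\mathbb{R})$ denotes the adjoint, with respect to the standard inner products, of the boundary operator of $T$;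 equivalently, $\partial^*$ followed by the orthogonal projection $C_d(X;\mathbb{R})\to C_d(T;\mathbb{R})$. *)

theory Defs
  imports
    "HOL-Analysis.Analysis"
    "HOL-Homology.Homology"
    "Jordan_Normal_Form.Determinant"
begin

section \<open>Finite CW complexes\<close>

text \<open>
  As in the library's \<^const>\<open>nsphere\<close>, points of Euclidean n-space are the sequences
  vanishing from index n on.  For n = 0 the sphere bounding the disc is empty.
\<close>

definition disc :: "nat \<Rightarrow> (nat \<Rightarrow> real) set" where
  "disc n = {x \<in> topspace (Euclidean_space n). (\<Sum>i<n. (x i)\<^sup>2) \<le> 1}"

definition open_disc :: "nat \<Rightarrow> (nat \<Rightarrow> real) set" where
  "open_disc n = {x \<in> topspace (Euclidean_space n). (\<Sum>i<n. (x i)\<^sup>2) < 1}"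

definition disc_boundary :: "nat \<Rightarrow> (nat \<Rightarrow> real) set" where
  "disc_boundary n = {x \<in> topspace (Euclidean_space n). (\<Sum>i<n. (x i)\<^sup>2) = 1}"

definition cell :: "('c \<Rightarrow> nat) \<Rightarrow> ('c \<Rightarrow> (nat \<Rightarrow> real) \<Rightarrow> 'a) \<Rightarrow> 'c \<Rightarrow> 'a set" where
  "cell dm \<Phi> c = \<Phi> c ` open_disc (dm c)"

text \<open>
  \<open>K\<close> indexes the cells, \<open>dm c\<close> is the dimension of the cell c and \<open>\<Phi> c\<close> its characteristic
  map.  Closure-finiteness and the weak topology are automatic for finitely many cells.
\<close>

definition finite_CW_complex ::
  "'a topology \<Rightarrow> 'c set \<Rightarrow> ('c \<Rightarrow> nat) \<Rightarrow> ('c \<Rightarrow> (nat \<Rightarrow> real) \<Rightarrow> 'a) \<Rightarrow> bool" where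
  "finite_CW_complex X K dm \<Phi> \<longleftrightarrow>
     Hausdorff_space X \<and> finite K \<and>
     disjoint_family_on (cell dm \<Phi>) K \<and>
     (\<Union>c\<in>K. cell dm \<Phi> c) = topspace X \<and>
     (\<forall>c\<in>K.
        continuous_map (subtopology (Euclidean_space (dm c)) (disc (dm c))) X (\<Phi> c) \<and>
        homeomorphic_map (subtopology (Euclidean_space (dm c)) (open_disc (dm c)))
          (subtopology X (cell dm \<Phi> c)) (\<Phi> c) \<and>
        \<Phi> c ` disc_boundary (dm c) \<subseteq> (\<Union>e\<in>{e\<in>K. dm e < dm c}. cell dm \<Phi> e))"

definition CW_dimension :: "'c set \<Rightarrow> ('c \<Rightarrow> nat) \<Rightarrow> nat \<Rightarrow> bool" where
  "CW_dimension K dm d \<longleftrightarrow> (\<exists>c\<in>K. dm c = d) \<and> (\<forall>c\<in>K. dm c \<le> d)"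

definition skeleton :: "'c set \<Rightarrow> ('c \<Rightarrow> nat) \<Rightarrow> nat \<Rightarrow> 'c set" where
  "skeleton K dm n = {c\<in>K. dm c \<le> n}"

text \<open>
  A subcomplex is a closed subspace that is a union of cells; it is represented by its set of
  cells \<open>T\<close> and is itself a CW complex with the same characteristic maps.
\<close>

definition subcomplex ::
  "'a topology \<Rightarrow> 'c set \<Rightarrow> ('c \<Rightarrow> nat) \<Rightarrow> ('c \<Rightarrow> (nat \<Rightarrow> real) \<Rightarrow> 'a) \<Rightarrow> 'c set \<Rightarrow> bool" where
  "subcomplex X K dm \<Phi> T \<longleftrightarrow> T \<subseteq> K \<and> closedin X (\<Union>c\<in>T. cell dm \<Phi> c)"


section \<open>Cellular chains and homology\<close>

text \<open>
  \<open>disc_to_sphere n\<close> maps the open n-disc homeomorphically onto the n-sphere minus its south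
  pole and the boundary of the disc to the south pole.  For n = 0 it maps the point to +1
  (the south pole being -1), so that a 1-cell has boundary \<open>\<Phi> c 1 - \<Phi> c (-1)\<close>.
\<close>

definition disc_to_sphere :: "nat \<Rightarrow> (nat \<Rightarrow> real) \<Rightarrow> nat \<Rightarrow> real" where
  "disc_to_sphere n x = (let r2 = (\<Sum>i<n. (x i)\<^sup>2) in
     (\<lambda>i. if i < n then 2 * sqrt (1 - r2) * x i else if i = n then 1 - 2 * r2 else 0))"

definition south_pole :: "nat \<Rightarrow> nat \<Rightarrow> real" where
  "south_pole n = (\<lambda>i. if i = n then -1 else 0)"

text \<open>
  For an n-cell e, this is the map from the n-skeleton to the n-sphere that collapses the
  complement of e to a point.
\<close>

definition collapse ::
  "('c \<Rightarrow> nat) \<Rightarrow> ('c \<Rightarrow> (nat \<Rightarrow> real) \<Rightarrow> 'a) \<Rightarrow> 'c \<Rightarrow> 'a \<Rightarrow> nat \<Rightarrow> real" where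
  "collapse dm \<Phi> e p =
     (if p \<in> cell dm \<Phi> e then disc_to_sphere (dm e) (inv_into (open_disc (dm e)) (\<Phi> e) p)
      else south_pole (dm e))"

text \<open>
  The coefficient of the n-cell e in the cellular boundary of the (n+1)-cell c: the degree of
  the attaching map of c followed by the collapse onto e.
\<close>

definition incidence ::
  "('c \<Rightarrow> nat) \<Rightarrow> ('c \<Rightarrow> (nat \<Rightarrow> real) \<Rightarrow> 'a) \<Rightarrow> 'c \<Rightarrow> 'c \<Rightarrow> int" where
  "incidence dm \<Phi> c e = Brouwer_degree2 (dm e) (collapse dm \<Phi> e \<circ> \<Phi> c)"

text \<open>
  The chain group in degree k with coefficients in a subring A of the reals (below, the integers
  or all of \<open>UNIV\<close>), as the set of A-valued functions on cells supported on the k-cells of K.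
  The inner product of \<^typ>\<open>real^'c\<close> makes the cells orthonormal.
\<close>

definition chains :: "real set \<Rightarrow> 'c set \<Rightarrow> ('c \<Rightarrow> nat) \<Rightarrow> nat \<Rightarrow> (real^'c::finite) set" where
  "chains A K dm k =
     {x. (\<forall>c. vec_nth x c \<in> A) \<and> (\<forall>c. vec_nth x c \<noteq> 0 \<longrightarrow> c \<in> K \<and> dm c = k)}"

text \<open>
  The boundary operator from k-chains to (k-1)-chains of K, extended by zero to the orthogonal
  complement of the k-chains.  Its \<^const>\<open>adjoint\<close> is then the adjoint of the boundary operator,
  likewise extended by zero.
\<close>

definition bd ::
  "'c set \<Rightarrow> ('c \<Rightarrow> nat) \<Rightarrow> ('c \<Rightarrow> (nat \<Rightarrow> real) \<Rightarrow> 'a) \<Rightarrow> nat \<Rightarrow> real^'c::finite \<Rightarrow> real^'c" where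
  "bd K dm \<Phi> k x = (\<chi> e. if e \<in> K \<and> dm e + 1 = k
     then (\<Sum>c\<in>{c\<in>K. dm c = k}. of_int (incidence dm \<Phi> c e) * vec_nth x c) else 0)"

definition cycles ::
  "real set \<Rightarrow> 'c set \<Rightarrow> ('c \<Rightarrow> nat) \<Rightarrow> ('c \<Rightarrow> (nat \<Rightarrow> real) \<Rightarrow> 'a) \<Rightarrow> nat \<Rightarrow> (real^'c::finite) set"
  where "cycles A K dm \<Phi> k = {x \<in> chains A K dm k. bd K dm \<Phi> k x = 0}"

definition boundaries ::
  "real set \<Rightarrow> 'c set \<Rightarrow> ('c \<Rightarrow> nat) \<Rightarrow> ('c \<Rightarrow> (nat \<Rightarrow> real) \<Rightarrow> 'a) \<Rightarrow> nat \<Rightarrow> (real^'c::finite) set"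
  where "boundaries A K dm \<Phi> k = bd K dm \<Phi> (k + 1) ` chains A K dm (k + 1)"

definition cycle_group ::
  "real set \<Rightarrow> 'c set \<Rightarrow> ('c \<Rightarrow> nat) \<Rightarrow> ('c \<Rightarrow> (nat \<Rightarrow> real) \<Rightarrow> 'a) \<Rightarrow> nat \<Rightarrow> (real^'c::finite) monoid"
  where "cycle_group A K dm \<Phi> k = \<lparr>carrier = cycles A K dm \<Phi> k, mult = (+), one = 0\<rparr>"

definition cellular_homology ::
  "real set \<Rightarrow> 'c set \<Rightarrow> ('c \<Rightarrow> nat) \<Rightarrow> ('c \<Rightarrow> (nat \<Rightarrow> real) \<Rightarrow> 'a) \<Rightarrow> nat
     \<Rightarrow> (real^'c::finite) set monoid"
  where "cellular_homology A K dm \<Phi> k = cycle_group A K dm \<Phi> k Mod boundaries A K dm \<Phi> k"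

text \<open>The dimension of the quotient of the real cycles by the real boundaries.\<close>

definition betti ::
  "('c::finite) set \<Rightarrow> ('c \<Rightarrow> nat) \<Rightarrow> ('c \<Rightarrow> (nat \<Rightarrow> real) \<Rightarrow> 'a) \<Rightarrow> nat \<Rightarrow> int" where
  "betti K dm \<Phi> k =
     int (dim (cycles UNIV K dm \<Phi> k)) - int (dim (boundaries UNIV K dm \<Phi> k))"

definition spanning_tree ::
  "'a topology \<Rightarrow> ('c::finite) set \<Rightarrow> ('c \<Rightarrow> nat) \<Rightarrow> ('c \<Rightarrow> (nat \<Rightarrow> real) \<Rightarrow> 'a) \<Rightarrow> nat
     \<Rightarrow> 'c set \<Rightarrow> bool" where
  "spanning_tree X K dm \<Phi> d T \<longleftrightarrow>
     subcomplex X K dm \<Phi> T \<and>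
     trivial_group (cellular_homology \<int> T dm \<Phi> d) \<and>
     betti T dm \<Phi> (d - 1) = betti K dm \<Phi> (d - 1) \<and>
     skeleton K dm (d - 1) \<subseteq> T"


section \<open>Determinants on subspaces and covolumes\<close>

definition basis_of :: "'v::real_vector set \<Rightarrow> 'v list \<Rightarrow> bool" where
  "basis_of V bs \<longleftrightarrow> distinct bs \<and> independent (set bs) \<and> span (set bs) = V"

definition det_on :: "'v::real_vector set \<Rightarrow> ('v \<Rightarrow> 'v) \<Rightarrow> real" where
  "det_on V f = (THE D. \<forall>bs M. basis_of V bs \<and> M \<in> carrier_mat (length bs) (length bs) \<and>
     (\<forall>j<length bs. f (bs ! j) = (\<Sum>i<length bs. (M $$ (i, j)) *\<^sub>R (bs ! i)))
     \<longrightarrow> D = Determinant.det M)"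

definition orthonormal_basis_of :: "'v::real_inner set \<Rightarrow> 'v list \<Rightarrow> bool" where
  "orthonormal_basis_of V es \<longleftrightarrow> basis_of V es \<and>
     (\<forall>i<length es. \<forall>j<length es. inner (es ! i) (es ! j) = (if i = j then 1 else 0))"

definition lattice_basis_of :: "'v::real_vector set \<Rightarrow> 'v set \<Rightarrow> 'v list \<Rightarrow> bool" where
  "lattice_basis_of V \<Lambda> bs \<longleftrightarrow> basis_of V bs \<and>
     \<Lambda> = {\<Sum>i<length bs. of_int (m i) *\<^sub>R (bs ! i) | m :: nat \<Rightarrow> int. True}"

text \<open>
  The covolume of a lattice \<open>\<Lambda>\<close> in V is the volume of the parallelepiped spanned by a
  \<open>\<int>\<close>-basis, i.e. the absolute value of the determinant of its coordinates in an orthonormal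
  basis of V.
\<close>

definition covolume :: "'v::real_inner set \<Rightarrow> 'v set \<Rightarrow> real" where
  "covolume V \<Lambda> = (THE v. \<forall>bs es. lattice_basis_of V \<Lambda> bs \<and> orthonormal_basis_of V es
     \<longrightarrow> v = \<bar>Determinant.det (mat (length es) (length bs) (\<lambda>(i, j). inner (es ! i) (bs ! j)))\<bar>)"


section \<open>Laplacians\<close>

definition laplacian ::
  "'c set \<Rightarrow> ('c \<Rightarrow> nat) \<Rightarrow> ('c \<Rightarrow> (nat \<Rightarrow> real) \<Rightarrow> 'a) \<Rightarrow> nat \<Rightarrow> real^'c::finite \<Rightarrow> real^'c" where
  "laplacian K dm \<Phi> d = bd K dm \<Phi> d \<circ> adjoint (bd K dm \<Phi> d)"

definition tree_laplacian ::
  "'c set \<Rightarrow> ('c \<Rightarrow> nat) \<Rightarrow> ('c \<Rightarrow> (nat \<Rightarrow> real) \<Rightarrow> 'a) \<Rightarrow> 'c set \<Rightarrow> nat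
     \<Rightarrow> real^'c::finite \<Rightarrow> real^'c" where
  "tree_laplacian K dm \<Phi> T d = bd K dm \<Phi> d \<circ> adjoint (bd T dm \<Phi> d)"

definition tree_weight ::
  "('c::finite) set \<Rightarrow> ('c \<Rightarrow> nat) \<Rightarrow> ('c \<Rightarrow> (nat \<Rightarrow> real) \<Rightarrow> 'a) \<Rightarrow> nat \<Rightarrow> real" where
  "tree_weight T dm \<Phi> d =
     (covolume (boundaries UNIV T dm \<Phi> (d - 1)) (boundaries \<int> T dm \<Phi> (d - 1)))\<^sup>2"

end

theory Submission
  imports Defs
begin

text \<open>
  Write \<open>u\<^sub>c\<close> for the cellular boundary of a d-cell \<open>c\<close> and \<open>V\<close> for the space of real
  (d-1)-boundaries, which is spanned by the \<open>u\<^sub>c\<close>.  On \<open>V\<close> the Laplacian is the frame operator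
  \<open>v \<mapsto> \<Sum>c. \<langle>u\<^sub>c, v\<rangle> u\<^sub>c\<close> of all d-cells, and the Laplacian of a tree \<open>T\<close> is the frame operator of
  the d-cells of \<open>T\<close> alone.

  In an orthonormal basis of \<open>V\<close> the frame operator of a family has the matrix \<open>W W\<^sup>T\<close>, where
  the columns of \<open>W\<close> are the coordinates of the vectors of the family.  Hence the Cauchy-Binet
  formula writes its determinant as the sum, over all sets \<open>S\<close> of \<open>dim V\<close> cells, of the
  determinants of the frame operators of the subfamilies (\<open>det_frame_operator_sum\<close>).  For such
  \<open>S\<close> the matrix \<open>W\<close> is square.  If the vectors of \<open>S\<close> are dependent, the determinant is 0
  (\<open>det_frame_operator_dependent\<close>).  Otherwise they form a basis of \<open>V\<close>, and \<open>(det W)\<^sup>2\<close> is the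
  squared covolume of the lattice that they span (\<open>det_frame_operator_covolume\<close>).

  The sets \<open>S\<close> that contribute are exactly the sets of d-cells of the spanning trees
  (\<open>spanning_tree_iff\<close>): adding any set of d-cells to the (d-1)-skeleton gives a subcomplex; since
  there are no (d+1)-cells, its integral homology in degree d is the group of integral relations
  between the \<open>u\<^sub>c\<close>, which vanishes if and only if the \<open>u\<^sub>c\<close> are independent over the reals; and
  since the (d-1)-cycles depend only on the (d-1)-skeleton, the condition on Betti numbers says
  that \<open>S\<close> spans a space of dimension \<open>dim V\<close>.  Moreover the integral (d-1)-boundaries of the tree
  are the lattice spanned by the \<open>u\<^sub>c\<close> with \<open>c \<in> S\<close>.
\<close>

section \<open>The Cauchy-Binet formula\<close>

lemma det_mat_Leibniz:
  "Determinant.det (mat r r (\<lambda>(i, j). f i j)) =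
     (\<Sum>p | p permutes {0..<r}. signof p * (\<Prod>i = 0..<r. f i (p i)))"
proof -
  have "(\<Prod>i = 0..<r. mat r r (\<lambda>(i, j). f i j) $$ (i, p i)) = (\<Prod>i = 0..<r. f i (p i))"
    if "p permutes {0..<r}" for p
    using permutes_in_image[OF that] by (intro prod.cong) auto
  then show ?thesis
    by (subst det_def'[of _ r]) auto
qed

lemma det_mat_mult:
  "Determinant.det (mat n n (\<lambda>(i, j). \<Sum>k<n. a i k * b k j)) =
     Determinant.det (mat n n (\<lambda>(i, j). a i j)) * Determinant.det (mat n n (\<lambda>(i, j). b i j))"
proof -
  have "mat n n (\<lambda>(i, j). \<Sum>k<n. a i k * b k j) = mat n n (\<lambda>(i, j). a i j) * mat n n (\<lambda>(i, j). b i j)"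
    by (rule eq_matI) (auto simp: scalar_prod_def lessThan_atLeast0)
  then show ?thesis
    by (simp add: Determinant.det_mult[of _ n])
qed

lemma det_mat_transpose:
  "Determinant.det (mat n n (\<lambda>(i, j). a j i)) = Determinant.det (mat n n (\<lambda>(i, j). a i j))"
proof -
  have "mat n n (\<lambda>(i, j). a j i) = transpose_mat (mat n n (\<lambda>(i, j). a i j))"
    by (rule eq_matI) auto
  then show ?thesis
    by (simp add: Determinant.det_transpose[of _ n])
qed

text \<open>
  Multilinearity of the determinant in the rows: each row is a sum over \<open>C\<close>, so expanding the
  determinant means to choose an element \<open>h i\<close> of \<open>C\<close> for every row \<open>i\<close>.
\<close>

lemma det_mat_sum_expand:
  fixes a :: "nat \<Rightarrow> 'b \<Rightarrow> 'r::comm_ring_1"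
  assumes "finite C"
  shows "Determinant.det (mat r r (\<lambda>(i, j). \<Sum>c\<in>C. a i c * b c j)) =
    (\<Sum>h\<in>{0..<r} \<rightarrow>\<^sub>E C. (\<Prod>i = 0..<r. a i (h i)) * Determinant.det (mat r r (\<lambda>(i, j). b (h i) j)))"
proof -
  have "Determinant.det (mat r r (\<lambda>(i, j). \<Sum>c\<in>C. a i c * b c j)) =
      (\<Sum>p | p permutes {0..<r}. \<Sum>h\<in>{0..<r} \<rightarrow>\<^sub>E C.
         signof p * (\<Prod>i = 0..<r. a i (h i) * b (h i) (p i)))"
    unfolding det_mat_Leibniz
    by (subst prod_sum_PiE) (auto simp: assms sum_distrib_left)
  also have "\<dots> = (\<Sum>h\<in>{0..<r} \<rightarrow>\<^sub>E C. \<Sum>p | p permutes {0..<r}.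
         signof p * (\<Prod>i = 0..<r. a i (h i) * b (h i) (p i)))"
    by (rule sum.swap)
  finally show ?thesis
    unfolding det_mat_Leibniz by (simp add: prod.distrib sum_distrib_left mult_ac)
qed

text \<open>
  In the expansion by choice functions \<open>h\<close>, a non-injective \<open>h\<close> contributes 0 because two rows
  are proportional.  Grouping the injective ones by their image \<open>S\<close>, which has \<open>r\<close> elements,
  collects the choice functions that occur in the same expansion for \<open>S\<close> instead of \<open>C\<close>.
  Leaving the summand for \<open>S\<close> as a determinant of a sum, rather than as a product of two minors,
  avoids any choice of an enumeration of \<open>S\<close>.
\<close>

theorem Cauchy_Binet:
  fixes a :: "nat \<Rightarrow> 'b \<Rightarrow> 'r::comm_ring_1"
  assumes C: "finite C"
  shows "Determinant.det (mat r r (\<lambda>(i, j). \<Sum>c\<in>C. a i c * b c j)) =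
    (\<Sum>S | S \<subseteq> C \<and> card S = r. Determinant.det (mat r r (\<lambda>(i, j). \<Sum>c\<in>S. a i c * b c j)))"
proof -
  define g where "g h = (\<Prod>i = 0..<r. a i (h i)) * Determinant.det (mat r r (\<lambda>(i, j). b (h i) j))" for h
  let ?I = "\<lambda>S. {h \<in> {0..<r} \<rightarrow>\<^sub>E S. inj_on h {0..<r}}"
  have expand: "Determinant.det (mat r r (\<lambda>(i, j). \<Sum>c\<in>S. a i c * b c j)) = sum g (?I S)"
    if S: "finite S" for S
  proof -
    have "g h = 0" if noninj: "\<not> inj_on h {0..<r}" for h
    proof -
      obtain i j where ij: "i < r" "j < r" "i \<noteq> j" "h i = h j"
        using noninj unfolding inj_on_def by auto
      have "Determinant.det (mat r r (\<lambda>(i, j). b (h i) j)) = 0"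
        by (rule Determinant.det_identical_rows[of _ r i j]) (use ij in auto)
      then show ?thesis by (simp add: g_def)
    qed
    then have "sum g ({0..<r} \<rightarrow>\<^sub>E S) = sum g (?I S)"
      by (intro sum.mono_neutral_right finite_PiE) (use S in auto)
    then show ?thesis
      unfolding det_mat_sum_expand[OF S] g_def .
  qed
  have fibre: "{h \<in> ?I C. h ` {0..<r} = S} = ?I S" if "S \<subseteq> C" "card S = r" for S
  proof -
    have fS: "finite S" using that C finite_subset by blast
    have "h ` {0..<r} = S" if "h \<in> ?I S" for h
      using that \<open>card S = r\<close> fS by (intro card_subset_eq) (auto simp: card_image)
    then have "?I S \<subseteq> {h \<in> ?I C. h ` {0..<r} = S}"
      using \<open>S \<subseteq> C\<close> PiE_mono[of "{0..<r}" "\<lambda>_. S" "\<lambda>_. C"] by blast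
    moreover have "{h \<in> ?I C. h ` {0..<r} = S} \<subseteq> ?I S"
      by (auto simp: PiE_iff)
    ultimately show ?thesis by (simp only: subset_antisym)
  qed
  have "(\<Sum>S | S \<subseteq> C \<and> card S = r. sum g {h \<in> ?I C. h ` {0..<r} = S}) = sum g (?I C)"
    by (rule sum.group) (use C in \<open>auto simp: finite_PiE card_image\<close>)
  moreover have "(\<Sum>S | S \<subseteq> C \<and> card S = r. sum g {h \<in> ?I C. h ` {0..<r} = S}) =
      (\<Sum>S | S \<subseteq> C \<and> card S = r. sum g (?I S))"
    by (rule sum.cong[OF refl], rule arg_cong[of _ _ "sum g"], rule fibre) auto
  ultimately have "sum g (?I C) = (\<Sum>S | S \<subseteq> C \<and> card S = r. sum g (?I S))"
    by (simp only:)
  also have "\<dots> = (\<Sum>S | S \<subseteq> C \<and> card S = r. Determinant.det (mat r r (\<lambda>(i, j). \<Sum>c\<in>S. a i c * b c j)))"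
    using finite_subset[OF _ C] by (intro sum.cong expand[symmetric]) auto
  finally show ?thesis using expand[OF C] by simp
qed

section \<open>Determinants on subspaces\<close>

lemma sum_nth_distinct:
  assumes "distinct bs"
  shows "(\<Sum>i<length bs. g (bs ! i)) = sum g (set bs)"
  using bij_betw_nth[OF assms refl refl] by (rule sum.reindex_bij_betw)

lemma basis_of_length: "basis_of V bs \<Longrightarrow> length bs = dim V"
  unfolding basis_of_def
  by (metis distinct_card real_vector.dim_eq_card real_vector.span_span)

lemma basis_of_nth: "basis_of V bs \<Longrightarrow> i < length bs \<Longrightarrow> bs ! i \<in> V"
  unfolding basis_of_def by (metis nth_mem real_vector.span_base)

lemma basis_of_coords:
  assumes "basis_of V bs" "v \<in> V"
  obtains x where "v = (\<Sum>i<length bs. x i *\<^sub>R bs ! i)"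
proof -
  have "v \<in> span (set bs)" using assms by (auto simp: basis_of_def)
  then obtain u where "v = (\<Sum>b\<in>set bs. u b *\<^sub>R b)"
    by (auto simp: real_vector.span_finite)
  then have "v = (\<Sum>i<length bs. u (bs ! i) *\<^sub>R bs ! i)"
    using sum_nth_distinct[of bs "\<lambda>b. u b *\<^sub>R b"] assms by (simp add: basis_of_def)
  then show thesis by (rule that)
qed

lemma basis_of_coord_matrix:
  assumes "basis_of V bs" "\<And>j. j < n \<Longrightarrow> v j \<in> V"
  obtains P where "\<And>j. j < n \<Longrightarrow> v j = (\<Sum>i<length bs. P i j *\<^sub>R bs ! i)"
proof -
  have "\<forall>j\<in>{..<n}. \<exists>x. v j = (\<Sum>i<length bs. x i *\<^sub>R bs ! i)"
    using basis_of_coords assms by (metis lessThan_iff)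
  then obtain x where "\<forall>j\<in>{..<n}. v j = (\<Sum>i<length bs. x j i *\<^sub>R bs ! i)"
    by (rule bchoice[THEN exE])
  then show thesis by (intro that[of "\<lambda>i j. x j i"]) auto
qed

lemma basis_of_unique:
  assumes bs: "basis_of V bs"
    and eq: "(\<Sum>i<length bs. x i *\<^sub>R bs ! i) = (\<Sum>i<length bs. y i *\<^sub>R bs ! i)"
    and j: "j < length bs"
  shows "x j = y j"
proof -
  have d: "distinct bs" and ind: "independent (set bs)" using bs by (auto simp: basis_of_def)
  define z where "z i = x i - y i" for i
  define k where "k b = inv_into {..<length bs} ((!) bs) b" for b
  have inj: "inj_on ((!) bs) {..<length bs}"
    using d by (auto simp: inj_on_def nth_eq_iff_index_eq)
  have k: "k (bs ! i) = i" if "i < length bs" for i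
    unfolding k_def using inv_into_f_f[OF inj] that by simp
  have "(\<Sum>b\<in>set bs. z (k b) *\<^sub>R b) = (\<Sum>i<length bs. z i *\<^sub>R bs ! i)"
    unfolding sum_nth_distinct[OF d, symmetric] by (simp add: k)
  also have "\<dots> = 0"
    using eq by (simp add: z_def scaleR_diff_left sum_subtractf)
  finally have "\<forall>b\<in>set bs. z (k b) = 0"
    using ind real_vector.dependent_finite[OF finite_set, of bs] by auto
  then have "z (k (bs ! j)) = 0" using j by simp
  then show ?thesis by (simp add: k j z_def)
qed

text \<open>Substituting one system of linear combinations into another multiplies the coefficient matrices.\<close>

lemma sum_scaleR_comp:
  assumes "\<And>k. k < n \<Longrightarrow> cs k = (\<Sum>i<m. P i k *\<^sub>R bs i)"
  shows "(\<Sum>k<n. x k *\<^sub>R cs k) = (\<Sum>i<m. (\<Sum>k<n. P i k * x k) *\<^sub>R (bs i :: 'v::real_vector))"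
proof -
  have "(\<Sum>k<n. x k *\<^sub>R cs k) = (\<Sum>k<n. \<Sum>i<m. (P i k * x k) *\<^sub>R bs i)"
    using assms by (simp add: scaleR_sum_right mult.commute)
  then show ?thesis by (subst (asm) sum.swap) (simp add: scaleR_sum_left)
qed

text \<open>
  The two base changes are mutually inverse.  For real coefficients the product formula says that
  the determinants are nonzero; for integer coefficients it forces them to be \<open>\<plusminus>1\<close>.
\<close>

lemma det_change_of_basis:
  assumes bs: "basis_of V bs" and cs: "basis_of V cs" and n: "length bs = n" "length cs = n"
    and P: "\<And>j. j < n \<Longrightarrow> cs ! j = (\<Sum>i<n. P i j *\<^sub>R bs ! i)"
    and Q: "\<And>j. j < n \<Longrightarrow> bs ! j = (\<Sum>i<n. Q i j *\<^sub>R cs ! i)"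
  shows "Determinant.det (mat n n (\<lambda>(i, j). P i j)) * Determinant.det (mat n n (\<lambda>(i, j). Q i j)) = 1"
proof -
  have "(\<Sum>k<n. P i k * Q k j) = (if i = j then 1 else 0)" if "i < n" "j < n" for i j
  proof -
    have "(\<Sum>i<n. (if i = j then 1 else 0) *\<^sub>R bs ! i) = bs ! j"
      using that by (simp add: if_distrib[of "\<lambda>t. t *\<^sub>R _"] sum.delta cong: if_cong)
    also have "\<dots> = (\<Sum>i<n. (\<Sum>k<n. P i k * Q k j) *\<^sub>R bs ! i)"
      unfolding Q[OF that(2)] using P by (rule sum_scaleR_comp)
    finally show ?thesis
      using basis_of_unique[OF bs, of "\<lambda>i. if i = j then 1 else 0" "\<lambda>i. \<Sum>k<n. P i k * Q k j" i] that n
      by simp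
  qed
  then have "mat n n (\<lambda>(i, j). \<Sum>k<n. P i k * Q k j) = 1\<^sub>m n"
    by (intro eq_matI) auto
  then show ?thesis
    using det_mat_mult[of n P Q] by (simp add: Determinant.det_one)
qed

text \<open>
  The definite description in \<^const>\<open>det_on\<close> is well defined because the matrices \<open>A\<close> and \<open>M\<close> of
  \<open>f\<close> in two bases satisfy \<open>A P = P M\<close> for the invertible base change \<open>P\<close>.
\<close>

lemma det_on_eqI:
  assumes f: "linear f" and bs: "basis_of V bs" and n: "length bs = n"
    and A: "\<And>j. j < n \<Longrightarrow> f (bs ! j) = (\<Sum>i<n. A i j *\<^sub>R bs ! i)"
  shows "det_on V f = Determinant.det (mat n n (\<lambda>(i, j). A i j))"
  unfolding det_on_def
proof (rule the_equality)
  let ?P = "\<lambda>D. \<forall>bs M. basis_of V bs \<and> M \<in> carrier_mat (length bs) (length bs) \<and>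
     (\<forall>j<length bs. f (bs ! j) = (\<Sum>i<length bs. (M $$ (i, j)) *\<^sub>R (bs ! i)))
     \<longrightarrow> D = Determinant.det M"
  show "D = Determinant.det (mat n n (\<lambda>(i, j). A i j))" if D: "?P D" for D
    using bs n A D[rule_format, of bs "mat n n (\<lambda>(i, j). A i j)"] by auto
  show "?P (Determinant.det (mat n n (\<lambda>(i, j). A i j)))"
  proof (intro allI impI, elim conjE)
    fix cs M
    assume cs: "basis_of V cs" and M: "M \<in> carrier_mat (length cs) (length cs)"
      and fM: "\<forall>j<length cs. f (cs ! j) = (\<Sum>i<length cs. (M $$ (i, j)) *\<^sub>R (cs ! i))"
    have n': "length cs = n" using basis_of_length[OF bs] basis_of_length[OF cs] n by simp
    obtain P where P: "\<And>j. j < n \<Longrightarrow> cs ! j = (\<Sum>i<n. P i j *\<^sub>R bs ! i)"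
      using basis_of_coord_matrix[OF bs, of n "(!) cs"] basis_of_nth[OF cs] n n' by metis
    obtain Q where Q: "\<And>j. j < n \<Longrightarrow> bs ! j = (\<Sum>i<n. Q i j *\<^sub>R cs ! i)"
      using basis_of_coord_matrix[OF cs, of n "(!) bs"] basis_of_nth[OF bs] n n' by metis
    let ?d = "\<lambda>A. Determinant.det (mat n n (\<lambda>(i, j). A i j))"
    let ?M = "\<lambda>i j. M $$ (i, j)"
    have "(\<Sum>k<n. A i k * P k j) = (\<Sum>k<n. P i k * M $$ (k, j))" if "i < n" "j < n" for i j
    proof -
      have "(\<Sum>i<n. (\<Sum>k<n. A i k * P k j) *\<^sub>R bs ! i) = (\<Sum>k<n. P k j *\<^sub>R f (bs ! k))"
        using A by (rule sum_scaleR_comp[symmetric])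
      also have "\<dots> = f (cs ! j)"
        using P that by (simp add: linear_sum[OF f] linear_scale[OF f])
      also have "\<dots> = (\<Sum>k<n. M $$ (k, j) *\<^sub>R cs ! k)" using fM n' that by simp
      also have "\<dots> = (\<Sum>i<n. (\<Sum>k<n. P i k * M $$ (k, j)) *\<^sub>R bs ! i)"
        using P by (rule sum_scaleR_comp)
      finally show ?thesis
        using basis_of_unique[OF bs, of "\<lambda>i. \<Sum>k<n. A i k * P k j" "\<lambda>i. \<Sum>k<n. P i k * M $$ (k, j)" i] n that
        by simp
    qed
    then have "mat n n (\<lambda>(i, j). \<Sum>k<n. A i k * P k j) = mat n n (\<lambda>(i, j). \<Sum>k<n. P i k * ?M k j)"
      by (intro eq_matI) auto
    then have "?d A * ?d P = ?d P * ?d ?M"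
      by (simp only: det_mat_mult[symmetric])
    moreover have "?d P \<noteq> 0"
      using det_change_of_basis[OF bs cs n n', of P Q] P Q by auto
    ultimately have "?d A = ?d ?M" by simp
    moreover have "mat n n (\<lambda>(i, j). M $$ (i, j)) = M"
      using M n' by (intro eq_matI) auto
    ultimately show "?d A = Determinant.det M" by (simp only:)
  qed
qed

section \<open>Frame operators\<close>

definition frame_operator :: "('c \<Rightarrow> 'v::real_inner) \<Rightarrow> 'c set \<Rightarrow> 'v \<Rightarrow> 'v" where
  "frame_operator u S v = (\<Sum>c\<in>S. inner (u c) v *\<^sub>R u c)"

lemma linear_frame_operator: "linear (frame_operator u S)"
  by (rule linearI)
    (simp_all add: frame_operator_def inner_add_right algebra_simps sum.distrib scaleR_sum_right)

lemma frame_operator_mem: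
  "subspace V \<Longrightarrow> u ` S \<subseteq> V \<Longrightarrow> frame_operator u S v \<in> V"
  unfolding frame_operator_def by (intro subspace_sum subspace_mul) auto

lemma orthonormal_basis_of_exists:
  fixes V :: "'v::euclidean_space set"
  assumes "subspace V"
  obtains es where "orthonormal_basis_of V es"
proof -
  obtain B where B: "pairwise Linear_Algebra.orthogonal B" "\<And>x. x \<in> B \<Longrightarrow> norm x = 1" "independent B" "span B = V"
    using orthonormal_basis_subspace[OF assms] by metis
  obtain es where es: "set es = B" "distinct es"
    using finite_distinct_list[OF independent_imp_finite[OF B(3)]] by auto
  have "inner (es ! i) (es ! j) = (if i = j then 1 else 0)" if "i < length es" "j < length es" for i j
  proof (cases "i = j")
    case True
    then show ?thesis using B(2) es(1) nth_mem[OF that(1)] by (simp add: norm_eq_1)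
  next
    case False
    then have "es ! i \<noteq> es ! j" using es(2) that by (simp add: nth_eq_iff_index_eq)
    then have "Linear_Algebra.orthogonal (es ! i) (es ! j)"
      using B(1) es(1) that nth_mem unfolding pairwise_def by metis
    then show ?thesis using False by (simp add: Linear_Algebra.orthogonal_def)
  qed
  then show thesis
    using that[of es] B es by (simp add: orthonormal_basis_of_def basis_of_def)
qed

lemma orthonormal_basis_expand:
  assumes es: "orthonormal_basis_of V es" and v: "v \<in> V"
  shows "v = (\<Sum>i<length es. inner (es ! i) v *\<^sub>R es ! i)"
proof -
  obtain x where x: "v = (\<Sum>i<length es. x i *\<^sub>R es ! i)"
    using basis_of_coords es v unfolding orthonormal_basis_of_def by metis
  have "inner (es ! j) v = x j" if j: "j < length es" for j
  proof -
    have "inner (es ! j) v = (\<Sum>i<length es. x i * inner (es ! j) (es ! i))"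
      unfolding x by (simp add: inner_sum_right)
    also have "\<dots> = (\<Sum>i<length es. if i = j then x i else 0)"
      using es j unfolding orthonormal_basis_of_def by (intro sum.cong) auto
    also have "\<dots> = x j" using j by simp
    finally show ?thesis .
  qed
  then have "(\<Sum>i<length es. inner (es ! i) v *\<^sub>R es ! i) = (\<Sum>i<length es. x i *\<^sub>R es ! i)"
    by (intro sum.cong) auto
  then show ?thesis using x by simp
qed

lemma orthonormal_basis_Parseval:
  assumes es: "orthonormal_basis_of V es" and "v \<in> V"
  shows "inner v w = (\<Sum>i<length es. inner (es ! i) v * inner (es ! i) w)"
  by (subst orthonormal_basis_expand[OF assms]) (simp add: inner_sum_left)

lemma orthonormal_basis_nth: "orthonormal_basis_of V es \<Longrightarrow> i < length es \<Longrightarrow> es ! i \<in> V"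
  using basis_of_nth unfolding orthonormal_basis_of_def by blast

lemma orthonormal_basis_length: "orthonormal_basis_of V es \<Longrightarrow> length es = dim V"
  using basis_of_length unfolding orthonormal_basis_of_def by blast

lemma det_on_orthonormal:
  assumes f: "linear f" and V: "\<And>v. v \<in> V \<Longrightarrow> f v \<in> V" and es: "orthonormal_basis_of V es"
  shows "det_on V f =
    Determinant.det (mat (length es) (length es) (\<lambda>(i, j). inner (es ! i) (f (es ! j))))"
proof (rule det_on_eqI[OF f _ refl])
  show "basis_of V es" using es by (simp add: orthonormal_basis_of_def)
  show "f (es ! j) = (\<Sum>i<length es. inner (es ! i) (f (es ! j)) *\<^sub>R es ! i)"
    if "j < length es" for j
    using orthonormal_basis_expand[OF es V[OF orthonormal_basis_nth[OF es that]]] .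
qed

lemma det_on_eq_0:
  fixes V :: "'v::euclidean_space set"
  assumes f: "linear f" and V: "subspace V" "\<And>v. v \<in> V \<Longrightarrow> f v \<in> V"
    and v: "v \<in> V" "v \<noteq> 0" "f v = 0"
  shows "det_on V f = 0"
proof -
  obtain es where es: "orthonormal_basis_of V es"
    using orthonormal_basis_of_exists[OF V(1)] .
  define n where "n = length es"
  let ?M = "mat n n (\<lambda>(i, j). inner (es ! i) (f (es ! j)))"
  let ?x = "Matrix.vec n (\<lambda>i. inner (es ! i) v)"
  have ex: "v = (\<Sum>i<n. inner (es ! i) v *\<^sub>R es ! i)"
    using orthonormal_basis_expand[OF es v(1)] by (simp add: n_def)
  have "?x \<noteq> 0\<^sub>v n"
  proof
    assume "?x = 0\<^sub>v n"
    then have "inner (es ! i) v = 0" if "i < n" for i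
      using that by (metis index_vec index_zero_vec(1))
    then have "v = 0" by (subst ex) simp
    then show False using v by simp
  qed
  moreover have "?M *\<^sub>v ?x = 0\<^sub>v n"
  proof (rule eq_vecI)
    fix i assume i: "i < dim_vec (0\<^sub>v n :: real Matrix.vec)"
    then have "vec_index (?M *\<^sub>v ?x) i = (\<Sum>j<n. inner (es ! i) (f (es ! j)) * inner (es ! j) v)"
      by (simp add: scalar_prod_def lessThan_atLeast0)
    also have "\<dots> = inner (es ! i) (\<Sum>j<n. inner (es ! j) v *\<^sub>R f (es ! j))"
      by (simp add: inner_sum_right mult.commute)
    also have "(\<Sum>j<n. inner (es ! j) v *\<^sub>R f (es ! j)) = f v"
      using arg_cong[OF ex, of f] by (simp add: linear_sum[OF f] linear_scale[OF f])
    finally show "vec_index (?M *\<^sub>v ?x) i = vec_index (0\<^sub>v n) i"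
      using v i by simp
  qed auto
  ultimately have "Determinant.det ?M = 0"
    by (subst Determinant.det_0_iff_vec_prod_zero[of _ n]) (auto intro!: exI[of _ ?x])
  then show ?thesis
    using det_on_orthonormal[OF f V(2) es] by (simp add: n_def)
qed

lemma det_frame_operator_orthonormal:
  assumes V: "subspace V" "u ` S \<subseteq> V" and es: "orthonormal_basis_of V es" and n: "length es = n"
  shows "det_on V (frame_operator u S) =
    Determinant.det (mat n n (\<lambda>(i, j). \<Sum>c\<in>S. inner (es ! i) (u c) * inner (u c) (es ! j)))"
proof -
  have "inner (es ! i) (frame_operator u S (es ! j)) =
      (\<Sum>c\<in>S. inner (es ! i) (u c) * inner (u c) (es ! j))" for i j
    by (simp add: frame_operator_def inner_sum_right mult.commute)
  then show ?thesis
    using det_on_orthonormal[OF linear_frame_operator frame_operator_mem[OF V] es] n by simp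
qed

text \<open>The Cauchy-Binet formula in basis-free form.\<close>

theorem det_frame_operator_sum:
  fixes V :: "'v::euclidean_space set"
  assumes V: "subspace V" and u: "u ` C \<subseteq> V" and C: "finite C"
  shows "det_on V (frame_operator u C) =
    (\<Sum>S | S \<subseteq> C \<and> card S = dim V. det_on V (frame_operator u S))"
proof -
  obtain es where es: "orthonormal_basis_of V es"
    using orthonormal_basis_of_exists[OF V] .
  note n = orthonormal_basis_length[OF es]
  have "det_on V (frame_operator u S) = Determinant.det (mat (dim V) (dim V)
      (\<lambda>(i, j). \<Sum>c\<in>S. inner (es ! i) (u c) * inner (u c) (es ! j)))" if "S \<subseteq> C" for S
    using that u by (intro det_frame_operator_orthonormal[OF V _ es n]) auto
  then show ?thesis
    using Cauchy_Binet[OF C, of "dim V" "\<lambda>i c. inner (es ! i) (u c)" "\<lambda>c j. inner (u c) (es ! j)"]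
    by simp
qed

text \<open>
  A dependent family of \<open>dim V\<close> vectors spans a proper subspace of \<open>V\<close>; a vector of \<open>V\<close>
  orthogonal to that subspace is in the kernel of the frame operator.
\<close>

lemma det_frame_operator_dependent:
  fixes V :: "'v::euclidean_space set"
  assumes V: "subspace V" and u: "u ` S \<subseteq> V" and S: "finite S" "card S = dim V"
    and dep: "\<not> (inj_on u S \<and> independent (u ` S))"
  shows "det_on V (frame_operator u S) = 0"
proof -
  have "dim (span (u ` S)) < card S"
  proof (rule ccontr)
    assume "\<not> dim (span (u ` S)) < card S"
    then have le: "card S \<le> dim (u ` S)" by simp
    then have "card (u ` S) \<le> dim (u ` S)" using card_image_le[OF S(1), of u] by simp
    then have "independent (u ` S)"
      using S(1) by (intro card_le_dim_spanning[of _ "u ` S"]) (auto intro: span_base)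
    moreover have "inj_on u S"
      using le dim_le_card'[of "u ` S"] card_image_le[OF S(1), of u] S(1)
      by (intro eq_card_imp_inj_on) auto
    ultimately show False using dep by blast
  qed
  then have "span (u ` S) \<noteq> V" using S(2) by auto
  moreover have "span (u ` S) \<subseteq> V" using V u by (simp add: span_minimal)
  moreover have span_V: "span V = V" using V by (simp only: span_eq_iff)
  ultimately have "span (u ` S) \<subset> span V" unfolding span_V psubset_eq by blast
  then obtain v where v: "v \<noteq> 0" "v \<in> span V" "\<And>y. y \<in> span (u ` S) \<Longrightarrow> Linear_Algebra.orthogonal v y"
    using orthogonal_to_subspace_exists_gen by metis
  have "inner (u c) v = 0" if "c \<in> S" for c
    using v(3)[of "u c"] that by (simp add: Linear_Algebra.orthogonal_def span_base inner_commute)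
  then have "frame_operator u S v = 0" by (simp add: frame_operator_def)
  then show ?thesis
    using v span_V by (intro det_on_eq_0[OF linear_frame_operator V frame_operator_mem[OF V u], of v]) auto
qed

text \<open>
  If \<open>f\<close> is the frame operator, then \<open>\<langle>f v, v\<rangle>\<close> is the sum of the squares of the \<open>\<langle>u c, v\<rangle>\<close>, so a vector
  in the kernel is orthogonal to a spanning family and therefore 0.
\<close>

lemma bij_betw_frame_operator:
  fixes V :: "'v::euclidean_space set"
  assumes S: "finite S" and V: "span (u ` S) = V"
  shows "bij_betw (frame_operator u S) V V"
proof -
  have sub: "subspace V" and u: "u ` S \<subseteq> V" using V by (auto intro: span_base)
  let ?f = "frame_operator u S"
  note f = linear_frame_operator[of u S]
  have "v = 0" if v: "v \<in> V" "?f v = 0" for v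
  proof -
    have "(\<Sum>c\<in>S. (inner (u c) v)\<^sup>2) = inner (?f v) v"
      by (simp add: frame_operator_def inner_sum_left power2_eq_square)
    then have "\<forall>c\<in>S. (inner (u c) v)\<^sup>2 = 0"
      using v by (simp add: sum_nonneg_eq_0_iff[OF S])
    then have "Linear_Algebra.orthogonal v y" if "y \<in> u ` S" for y
      using that by (auto simp: Linear_Algebra.orthogonal_def inner_commute)
    then have "Linear_Algebra.orthogonal v v"
      using orthogonal_to_span[of v "u ` S" v] v V by blast
    then show "v = 0" by (simp add: Linear_Algebra.orthogonal_def)
  qed
  then have inj: "inj_on ?f V"
    using linear_injective_on_subspace_0[OF f sub] by blast
  have "?f ` V \<subseteq> V" using frame_operator_mem[OF sub u] by auto
  moreover have "dim (?f ` V) = dim V"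
    using dim_image_eq[OF f] inj sub by (simp add: span_eq_iff[THEN iffD2])
  ultimately have "?f ` V = V"
    using subspace_dim_equal[OF linear_subspace_image[OF f sub] sub] by simp
  then show ?thesis using inj by (simp add: bij_betw_def)
qed

section \<open>Gram determinants and covolumes\<close>

text \<open>
  By Parseval the Gram matrix is \<open>B\<^sup>T B\<close>, where \<open>B\<close> holds the coordinates in an orthonormal
  basis.  The left-hand side does not mention that basis, so neither does the absolute value of
  \<open>det B\<close> depend on it.
\<close>

lemma det_Gram_orthonormal:
  assumes es: "orthonormal_basis_of V es" "length es = n" and bs: "\<And>j. j < n \<Longrightarrow> bs ! j \<in> V"
  shows "Determinant.det (mat n n (\<lambda>(i, j). inner (bs ! i) (bs ! j))) =
    (Determinant.det (mat n n (\<lambda>(i, j). inner (es ! i) (bs ! j))))\<^sup>2"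
proof -
  have "mat n n (\<lambda>(i, j). inner (bs ! i) (bs ! j)) =
      mat n n (\<lambda>(i, j). \<Sum>k<n. inner (es ! k) (bs ! i) * inner (es ! k) (bs ! j))"
    using orthonormal_basis_Parseval[OF es(1) bs] es(2) by (intro eq_matI) auto
  then show ?thesis
    using det_mat_mult[of n "\<lambda>i k. inner (es ! k) (bs ! i)" "\<lambda>k j. inner (es ! k) (bs ! j)"]
      det_mat_transpose[of n "\<lambda>i k. inner (es ! i) (bs ! k)"]
    by (simp add: power2_eq_square)
qed

lemma lattice_basis_nth:
  assumes "lattice_basis_of V \<Lambda> bs" "j < length bs"
  shows "bs ! j \<in> \<Lambda>"
proof -
  have eq: "bs ! j = (\<Sum>i<length bs. of_int (if i = j then 1 else 0) *\<^sub>R bs ! i)"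
    using assms(2) by (subst sum.remove[of _ j]) (auto intro!: sum.neutral)
  have \<Lambda>: "\<Lambda> = {\<Sum>i<length bs. of_int (m i) *\<^sub>R (bs ! i) | m :: nat \<Rightarrow> int. True}"
    using assms(1) by (simp add: lattice_basis_of_def)
  show ?thesis
    unfolding \<Lambda> by (intro CollectI exI[of _ "\<lambda>i. if i = j then 1 else 0"] conjI TrueI eq)
qed

lemma lattice_basis_coord_matrix:
  assumes "lattice_basis_of V \<Lambda> bs" "\<And>j. j < n \<Longrightarrow> v j \<in> \<Lambda>"
  obtains P :: "nat \<Rightarrow> nat \<Rightarrow> int"
  where "\<And>j. j < n \<Longrightarrow> v j = (\<Sum>i<length bs. of_int (P i j) *\<^sub>R bs ! i)"
proof -
  have "\<forall>j\<in>{..<n}. \<exists>m :: nat \<Rightarrow> int. v j = (\<Sum>i<length bs. of_int (m i) *\<^sub>R bs ! i)"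
    using assms unfolding lattice_basis_of_def by blast
  then obtain x :: "nat \<Rightarrow> nat \<Rightarrow> int"
    where "\<forall>j\<in>{..<n}. v j = (\<Sum>i<length bs. of_int (x j i) *\<^sub>R bs ! i)"
    by (rule bchoice[THEN exE])
  then show thesis by (intro that[of "\<lambda>i j. x j i"]) auto
qed

lemma det_of_int:
  "Determinant.det (mat n n (\<lambda>(i, j). of_int (P i j))) = (of_int (Determinant.det (mat n n (\<lambda>(i, j). P i j))) :: real)"
proof -
  have "mat n n (\<lambda>(i, j). of_int (P i j)) = map_mat (of_int :: int \<Rightarrow> real) (mat n n (\<lambda>(i, j). P i j))"
    by (rule eq_matI) auto
  then show ?thesis by (simp add: of_int_hom.hom_det)
qed

text \<open>Two bases of the same lattice differ by an integer matrix of determinant \<open>\<plusminus>1\<close>.\<close>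

lemma det_Gram_lattice_bases:
  assumes bs: "lattice_basis_of V \<Lambda> bs" and cs: "lattice_basis_of V \<Lambda> cs"
    and n: "length bs = n" "length cs = n"
  shows "Determinant.det (mat n n (\<lambda>(i, j). inner (cs ! i) (cs ! j))) =
    Determinant.det (mat n n (\<lambda>(i, j). inner (bs ! i) (bs ! j)))"
proof -
  obtain P :: "nat \<Rightarrow> nat \<Rightarrow> int" where P: "\<And>j. j < n \<Longrightarrow> cs ! j = (\<Sum>i<n. of_int (P i j) *\<^sub>R bs ! i)"
    using lattice_basis_coord_matrix[OF bs, of n "(!) cs"] lattice_basis_nth[OF cs] n by metis
  obtain Q :: "nat \<Rightarrow> nat \<Rightarrow> int" where Q: "\<And>j. j < n \<Longrightarrow> bs ! j = (\<Sum>i<n. of_int (Q i j) *\<^sub>R cs ! i)"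
    using lattice_basis_coord_matrix[OF cs, of n "(!) bs"] lattice_basis_nth[OF bs] n by metis
  let ?d = "\<lambda>A. Determinant.det (mat n n (\<lambda>(i, j). A i j))"
  let ?p = "\<lambda>i j. real_of_int (P i j)" and ?g = "\<lambda>i j. inner (bs ! i) (bs ! j)"
  have "basis_of V bs" "basis_of V cs" using bs cs by (auto simp: lattice_basis_of_def)
  from det_change_of_basis[OF this n P Q]
  have "real_of_int (?d P) * real_of_int (?d Q) = 1" by (simp only: det_of_int)
  then have "?d P * ?d Q = 1" by (metis of_int_1 of_int_eq_iff of_int_mult)
  then have "?d P * ?d P = 1" using zmult_eq_1_iff by (metis mult_minus_left mult_minus_right)
  then have unimodular: "?d ?p * ?d ?p = 1" by (simp only: det_of_int of_int_mult[symmetric] of_int_1)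
  have "inner (cs ! i) (cs ! j) = (\<Sum>l<n. ?p l i * (\<Sum>k<n. ?g l k * ?p k j))"
    if "i < n" "j < n" for i j
  proof -
    have "inner (bs ! l) (cs ! j) = (\<Sum>k<n. ?g l k * ?p k j)" for l
      using P[OF that(2)] by (simp add: inner_sum_right mult.commute)
    moreover have "inner (cs ! i) (cs ! j) = (\<Sum>l<n. ?p l i * inner (bs ! l) (cs ! j))"
      by (subst P[OF that(1)]) (simp add: inner_sum_left)
    ultimately show ?thesis by simp
  qed
  then have "mat n n (\<lambda>(i, j). inner (cs ! i) (cs ! j)) =
      mat n n (\<lambda>(i, j). \<Sum>l<n. ?p l i * (\<Sum>k<n. ?g l k * ?p k j))"
    by (intro eq_matI) auto
  then have "?d (\<lambda>i j. inner (cs ! i) (cs ! j)) = ?d (\<lambda>i l. ?p l i) * (?d ?g * ?d ?p)"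
    by (simp only: det_mat_mult)
  also have "\<dots> = (?d ?p * ?d ?p) * ?d ?g"
    by (simp only: det_mat_transpose[of n ?p] mult_ac)
  finally show ?thesis using unimodular by simp
qed

text \<open>
  The definite description in \<^const>\<open>covolume\<close> is well defined: every admissible value is the
  square root of the Gram determinant of a lattice basis, and that is the same for all of them.
\<close>

lemma covolume_eq:
  assumes bs: "lattice_basis_of V \<Lambda> bs" and es: "orthonormal_basis_of V es"
    and n: "length bs = n" "length es = n"
  shows "covolume V \<Lambda> = \<bar>Determinant.det (mat n n (\<lambda>(i, j). inner (es ! i) (bs ! j)))\<bar>"
  unfolding covolume_def
proof (rule the_equality)
  let ?g = "\<lambda>bs. Determinant.det (mat n n (\<lambda>(i, j). inner (bs ! i) (bs ! j)))"
  let ?v = "\<lambda>es bs. \<bar>Determinant.det (mat (length es) (length bs) (\<lambda>(i, j). inner (es ! i) (bs ! j)))\<bar>"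
  have v: "?v fs cs = sqrt (?g cs)" and len: "length cs = n"
    if cs: "lattice_basis_of V \<Lambda> cs" and fs: "orthonormal_basis_of V fs" for cs fs
  proof -
    have *: "length fs = n" "length cs = n"
      using fs cs es bs n basis_of_length[of V]
      unfolding orthonormal_basis_of_def lattice_basis_of_def by metis+
    then have "(?v fs cs)\<^sup>2 = ?g cs"
      using det_Gram_orthonormal[OF fs *(1), of cs] basis_of_nth[of V cs] cs
      by (simp add: lattice_basis_of_def)
    then show "?v fs cs = sqrt (?g cs)" by (metis abs_ge_zero real_sqrt_unique)
    show "length cs = n" by fact
  qed
  show "\<forall>cs fs. lattice_basis_of V \<Lambda> cs \<and> orthonormal_basis_of V fs \<longrightarrow>
      \<bar>Determinant.det (mat n n (\<lambda>(i, j). inner (es ! i) (bs ! j)))\<bar> = ?v fs cs"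
  proof (intro allI impI, elim conjE)
    fix cs fs assume "lattice_basis_of V \<Lambda> cs" "orthonormal_basis_of V fs"
    then show "\<bar>Determinant.det (mat n n (\<lambda>(i, j). inner (es ! i) (bs ! j)))\<bar> = ?v fs cs"
      using v[of cs fs] v[OF bs es] len[of cs fs]
        det_Gram_lattice_bases[OF bs, of cs n] n by simp
  qed
next
  fix v assume "\<forall>cs fs. lattice_basis_of V \<Lambda> cs \<and> orthonormal_basis_of V fs \<longrightarrow>
     v = \<bar>Determinant.det (mat (length fs) (length cs) (\<lambda>(i, j). inner (fs ! i) (cs ! j)))\<bar>"
  then show "v = \<bar>Determinant.det (mat n n (\<lambda>(i, j). inner (es ! i) (bs ! j)))\<bar>"
    using bs es n by auto
qed

text \<open>
  With \<open>W\<close> the matrix of coordinates of the basis \<open>u ` S\<close>, the determinant on the left is that of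
  \<open>W W\<^sup>T\<close>, and the covolume is the absolute value of \<open>det W\<close>.
\<close>

lemma det_frame_operator_covolume:
  fixes V :: "'v::euclidean_space set"
  assumes S: "finite S" and inj: "inj_on u S" and ind: "independent (u ` S)" and V: "span (u ` S) = V"
  shows "det_on V (frame_operator u S) =
    (covolume V {\<Sum>c\<in>S. of_int (m c) *\<^sub>R u c | m :: 'c \<Rightarrow> int. True})\<^sup>2"
proof -
  let ?L = "{\<Sum>c\<in>S. of_int (m c) *\<^sub>R u c | m :: 'c \<Rightarrow> int. True}"
  have sub: "subspace V" and u: "u ` S \<subseteq> V" using V by (auto intro: span_base)
  obtain es where es: "orthonormal_basis_of V es"
    using orthonormal_basis_of_exists[OF sub] .
  obtain xs where xs: "set xs = S" "distinct xs" using finite_distinct_list[OF S] by auto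
  define bs where "bs = map u xs"
  have basis: "basis_of V bs"
    using xs inj ind V by (simp add: basis_of_def bs_def distinct_map)
  define n where "n = dim V"
  have n: "length bs = n" "length es = n" "length xs = n"
    using basis_of_length[OF basis] orthonormal_basis_length[OF es] by (auto simp: n_def bs_def)
  have bs: "bs ! i = u (xs ! i)" if "i < n" for i using that n by (simp add: bs_def)
  have sum_xs: "(\<Sum>i<n. g (xs ! i)) = sum g S" for g :: "'c \<Rightarrow> 'w::comm_monoid_add"
    using sum_nth_distinct[OF xs(2), of g] xs n by simp
  have "?L = {\<Sum>i<n. of_int (m i) *\<^sub>R bs ! i | m :: nat \<Rightarrow> int. True}"
  proof (intro equalityI subsetI)
    fix x assume "x \<in> ?L"
    then obtain m :: "'c \<Rightarrow> int" where "x = (\<Sum>c\<in>S. of_int (m c) *\<^sub>R u c)" by auto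
    then have "x = (\<Sum>i<n. of_int (m (xs ! i)) *\<^sub>R bs ! i)"
      by (simp add: sum_xs[symmetric] bs)
    then show "x \<in> {\<Sum>i<n. of_int (m i) *\<^sub>R bs ! i | m :: nat \<Rightarrow> int. True}"
      by (intro CollectI exI[of _ "\<lambda>i. m (xs ! i)"]) simp
  next
    fix x assume "x \<in> {\<Sum>i<n. of_int (m i) *\<^sub>R bs ! i | m :: nat \<Rightarrow> int. True}"
    then obtain m :: "nat \<Rightarrow> int" where x: "x = (\<Sum>i<n. of_int (m i) *\<^sub>R bs ! i)" by auto
    define k where "k = inv_into {..<n} ((!) xs)"
    have "inj_on ((!) xs) {..<n}" using xs n by (auto simp: inj_on_def nth_eq_iff_index_eq)
    then have "k (xs ! i) = i" if "i < n" for i unfolding k_def using that by (intro inv_into_f_f) auto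
    then have "x = (\<Sum>c\<in>S. of_int (m (k c)) *\<^sub>R u c)"
      unfolding x by (simp add: sum_xs[symmetric] bs)
    then show "x \<in> ?L" by (intro CollectI exI[of _ "\<lambda>c. m (k c)"]) simp
  qed
  then have lat: "lattice_basis_of V ?L bs"
    using basis n by (simp add: lattice_basis_of_def)
  let ?W = "\<lambda>i j. inner (es ! i) (bs ! j)"
  have "(\<Sum>c\<in>S. inner (es ! i) (u c) * inner (u c) (es ! j)) = (\<Sum>k<n. ?W i k * ?W j k)" for i j
    by (simp add: sum_xs[symmetric] bs inner_commute)
  then have "det_on V (frame_operator u S) = Determinant.det (mat n n (\<lambda>(i, j). \<Sum>k<n. ?W i k * ?W j k))"
    using det_frame_operator_orthonormal[OF sub u es n(2)] by simp
  also have "\<dots> = (Determinant.det (mat n n (\<lambda>(i, j). ?W i j)))\<^sup>2"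
    using det_mat_mult[of n ?W "\<lambda>k j. ?W j k"] det_mat_transpose[of n ?W]
    by (simp add: power2_eq_square)
  also have "\<dots> = (covolume V ?L)\<^sup>2"
    using covolume_eq[OF lat es n(1,2)] by simp
  finally show ?thesis .
qed

section \<open>Independence over the integers and over the reals\<close>

lemma independent_family_iff:
  fixes u :: "'c \<Rightarrow> 'v::real_vector"
  assumes S: "finite S"
  shows "inj_on u S \<and> independent (u ` S) \<longleftrightarrow>
    (\<forall>x. (\<Sum>c\<in>S. x c *\<^sub>R u c) = 0 \<longrightarrow> (\<forall>c\<in>S. x c = 0))" (is "?L \<longleftrightarrow> ?R")
proof
  assume L: ?L
  show ?R
  proof (intro allI impI ballI)
    fix x c assume x: "(\<Sum>c\<in>S. x c *\<^sub>R u c) = 0" and c: "c \<in> S"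
    define k where "k = inv_into S u"
    have k: "k (u c) = c" if "c \<in> S" for c using L that by (simp add: k_def)
    have "(\<Sum>v\<in>u ` S. x (k v) *\<^sub>R v) = 0"
      using L x by (simp add: sum.reindex k)
    then have "\<forall>v\<in>u ` S. x (k v) = 0"
      using L real_vector.dependent_finite[of "u ` S"] S by auto
    then show "x c = 0" using c k by force
  qed
next
  assume R: ?R
  have inj: "inj_on u S"
  proof (rule inj_onI, rule ccontr)
    fix a b assume ab: "a \<in> S" "b \<in> S" "u a = u b" "a \<noteq> b"
    have "(\<Sum>c\<in>S. (if c = a then 1 else if c = b then - 1 else 0) *\<^sub>R u c) = u a - u b"
      using ab S by (simp add: sum.remove[of S a] sum.remove[of "S - {a}" b])
    then have "\<forall>c\<in>S. (if c = a then 1 else if c = b then - 1 else 0) = (0::real)"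
      using R[rule_format, of "\<lambda>c. if c = a then 1 else if c = b then - 1 else 0"] ab by simp
    then show False using ab by force
  qed
  moreover have "independent (u ` S)"
  proof
    assume "dependent (u ` S)"
    then obtain x where "\<exists>v\<in>u ` S. x v \<noteq> 0" "(\<Sum>v\<in>u ` S. x v *\<^sub>R v) = 0"
      using real_vector.dependent_finite[of "u ` S"] S by auto
    then show False using R[rule_format, of "\<lambda>c. x (u c)"] inj by (auto simp: sum.reindex)
  qed
  ultimately show ?L by simp
qed

text \<open>
  A family of integer vectors without integral relations is independent over the reals.  Its Gram
  matrix \<open>G\<close> is an integer matrix.  If \<open>det G = 0\<close>, then \<open>G v = 0\<close> for an integer vector \<open>v \<noteq> 0\<close>,
  since this holds over any integral domain; but then the combination of the family with
  coefficients \<open>v\<close> is orthogonal to itself, which makes \<open>v\<close> an integral relation.  So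
  \<open>det G \<noteq> 0\<close>, and \<open>G\<close>, seen as a real matrix, annihilates every real relation.
\<close>

lemma integer_independent_iff:
  fixes u :: "'c \<Rightarrow> real ^ 'e::finite"
  assumes S: "finite S" and int: "\<And>c e. c \<in> S \<Longrightarrow> vec_nth (u c) e \<in> \<int>"
  shows "inj_on u S \<and> independent (u ` S) \<longleftrightarrow>
    (\<forall>m :: 'c \<Rightarrow> int. (\<Sum>c\<in>S. of_int (m c) *\<^sub>R u c) = 0 \<longrightarrow> (\<forall>c\<in>S. m c = 0))" (is "?L \<longleftrightarrow> ?R")
proof
  show ?R if ?L
    using that unfolding independent_family_iff[OF S] by force
next
  assume R: ?R
  obtain xs where xs: "set xs = S" "distinct xs" using finite_distinct_list[OF S] by auto
  define n where "n = length xs"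
  have xS: "xs ! i \<in> S" if "i < n" for i using that xs nth_mem unfolding n_def by blast
  have sum_xs: "(\<Sum>i<n. g (xs ! i)) = sum g S" for g :: "'c \<Rightarrow> real ^ 'e"
    using sum_nth_distinct[OF xs(2), of g] xs n_def by simp
  define g where "g i j = \<lfloor>inner (u (xs ! i)) (u (xs ! j))\<rfloor>" for i j
  have g: "real_of_int (g i j) = inner (u (xs ! i)) (u (xs ! j))" if "i < n" "j < n" for i j
  proof -
    have "inner (u (xs ! i)) (u (xs ! j)) \<in> \<int>"
      unfolding inner_vec_def using int xS that by (intro Ints_sum) auto
    then show ?thesis unfolding g_def by (rule of_int_floor)
  qed
  let ?G = "mat n n (\<lambda>(i, j). g i j)" and ?RG = "mat n n (\<lambda>(i, j). real_of_int (g i j))"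
  have "Determinant.det ?G \<noteq> 0"
  proof
    assume "Determinant.det ?G = 0"
    then obtain v where v: "v \<in> carrier_vec n" "v \<noteq> 0\<^sub>v n" "?G *\<^sub>v v = 0\<^sub>v n"
      using Determinant.det_0_iff_vec_prod_zero[of ?G n] by auto
    define k where "k = inv_into {..<n} ((!) xs)"
    have "inj_on ((!) xs) {..<n}" using xs n_def by (auto simp: inj_on_def nth_eq_iff_index_eq)
    then have k: "k (xs ! i) = i" if "i < n" for i unfolding k_def using that by (intro inv_into_f_f) auto
    let ?w = "\<Sum>j<n. of_int (vec_index v j) *\<^sub>R u (xs ! j)"
    have "(\<Sum>j<n. real_of_int (vec_index v j) * inner (u (xs ! i)) (u (xs ! j))) = 0" if i: "i < n" for i
    proof -
      have "(\<Sum>j<n. vec_index v j * g i j) = vec_index (?G *\<^sub>v v) i"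
        using i v(1) by (simp add: scalar_prod_def lessThan_atLeast0 mult.commute)
      also have "\<dots> = 0" using v(3) i by simp
      finally have "real_of_int (\<Sum>j<n. vec_index v j * g i j) = 0" by simp
      then show ?thesis using g[OF i] by simp
    qed
    then have "inner (u (xs ! i)) ?w = 0" if "i < n" for i
      using that by (simp add: inner_sum_right)
    then have "inner ?w ?w = 0" by (subst inner_sum_left) simp
    then have "?w = 0" by simp
    then have "(\<Sum>c\<in>S. of_int (vec_index v (k c)) *\<^sub>R u c) = 0"
      by (simp add: sum_xs[symmetric] k)
    then have "\<forall>c\<in>S. vec_index v (k c) = 0" using R[rule_format, of "\<lambda>c. vec_index v (k c)"] by blast
    then have "vec_index v i = 0" if "i < n" for i using that xS k by force
    then have "v = 0\<^sub>v n" using v(1) by (intro eq_vecI) auto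
    then show False using v(2) by simp
  qed
  then have det: "Determinant.det ?RG \<noteq> 0" by (simp add: det_of_int)
  show ?L
    unfolding independent_family_iff[OF S]
  proof (intro allI impI)
    fix x assume "(\<Sum>c\<in>S. x c *\<^sub>R u c) = 0"
    then have x: "(\<Sum>i<n. x (xs ! i) *\<^sub>R u (xs ! i)) = 0"
      using sum_xs[of "\<lambda>c. x c *\<^sub>R u c"] by simp
    let ?x = "Matrix.vec n (\<lambda>i. x (xs ! i))"
    have "?RG *\<^sub>v ?x = 0\<^sub>v n"
    proof (rule eq_vecI)
      fix i assume "i < dim_vec (0\<^sub>v n :: real Matrix.vec)"
      then have i: "i < n" by simp
      then have "vec_index (?RG *\<^sub>v ?x) i = (\<Sum>j<n. real_of_int (g i j) * x (xs ! j))"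
        by (simp add: scalar_prod_def lessThan_atLeast0)
      also have "\<dots> = inner (u (xs ! i)) (\<Sum>j<n. x (xs ! j) *\<^sub>R u (xs ! j))"
        using g[OF i] by (simp add: inner_sum_right mult.commute)
      finally show "vec_index (?RG *\<^sub>v ?x) i = vec_index (0\<^sub>v n) i" using x i by simp
    qed auto
    then have "?x = 0\<^sub>v n"
      using det Determinant.det_0_iff_vec_prod_zero[OF mat_carrier, of n "\<lambda>(i, j). real_of_int (g i j)"]
        vec_carrier by blast
    then have *: "x (xs ! i) = 0" if "i < n" for i
      using that by (metis index_vec index_zero_vec(1))
    show "\<forall>c\<in>S. x c = 0"
    proof
      fix c assume "c \<in> S"
      then obtain i where "i < n" "c = xs ! i" using xs n_def by (metis in_set_conv_nth)
      then show "x c = 0" using * by simp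
    qed
  qed
qed

section \<open>Subcomplexes\<close>

lemma compactin_disc: "compactin (Euclidean_space n) (disc n)"
proof -
  let ?P = "product_topology (\<lambda>i. euclideanreal) (UNIV :: nat set)"
  have disc: "disc n = topspace (Euclidean_space n) \<inter> {x. (\<Sum>i<n. (x i)\<^sup>2) \<le> 1}"
    by (auto simp: disc_def)
  have "closed {x :: nat \<Rightarrow> real. (\<Sum>i<n. (x i)\<^sup>2) \<le> 1}"
    by (intro closed_Collect_le continuous_intros continuous_on_product_coordinates)
  then have "closedin ?P {x :: nat \<Rightarrow> real. (\<Sum>i<n. (x i)\<^sup>2) \<le> 1}"
    by (simp add: euclidean_product_topology)
  then have closed: "closedin ?P (disc n)"
    unfolding disc by (intro closedin_Int closedin_Euclidean_space)
  have "disc n \<subseteq> PiE UNIV (\<lambda>_. {-1..1})"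
  proof (intro subsetI PiE_I)
    fix x i assume x: "x \<in> disc n"
    show "x i \<in> {-1..1}"
    proof (cases "i < n")
      case True
      then have "(x i)\<^sup>2 \<le> (\<Sum>i<n. (x i)\<^sup>2)" by (intro member_le_sum) auto
      also have "\<dots> \<le> 1" using x by (simp add: disc_def)
      finally show ?thesis by (simp add: abs_square_le_1 abs_le_iff)
    next
      case False
      then show ?thesis using x by (simp add: disc_def topspace_Euclidean_space)
    qed
  qed auto
  moreover have "compactin ?P (PiE UNIV (\<lambda>_. {-1..1}))"
    by (simp add: compactin_PiE)
  ultimately have "compactin ?P (disc n)" using closed by (metis closed_compactin)
  then show ?thesis
    unfolding Euclidean_space_def compactin_subtopology
    by (auto simp: disc_def topspace_Euclidean_space)
qed

text \<open>
  A union of cells that contains all cells of lower dimension than any of its members is also the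
  union of the images of the closed discs.  These images are compact, hence closed in the
  Hausdorff space \<open>X\<close>.
\<close>

lemma subcomplexI:
  assumes CW: "finite_CW_complex X K dm \<Phi>" and T: "T \<subseteq> K"
    and down: "\<And>c e. c \<in> T \<Longrightarrow> e \<in> K \<Longrightarrow> dm e < dm c \<Longrightarrow> e \<in> T"
  shows "subcomplex X K dm \<Phi> T"
proof -
  have "closedin X (\<Phi> c ` disc (dm c))" if "c \<in> T" for c
  proof -
    have c: "c \<in> K" using that T by auto
    have "compactin (subtopology (Euclidean_space (dm c)) (disc (dm c))) (disc (dm c))"
      using compactin_disc by (simp add: compactin_subtopology)
    then have "compactin X (\<Phi> c ` disc (dm c))"
      using CW c unfolding finite_CW_complex_def by (blast intro: image_compactin)
    then show ?thesis
      using CW compactin_imp_closedin unfolding finite_CW_complex_def by blast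
  qed
  then have "closedin X (\<Union>c\<in>T. \<Phi> c ` disc (dm c))"
    using CW T by (intro closedin_Union) (auto simp: finite_CW_complex_def intro: finite_subset)
  also have "(\<Union>c\<in>T. \<Phi> c ` disc (dm c)) = (\<Union>c\<in>T. cell dm \<Phi> c)"
  proof -
    have "disc n = open_disc n \<union> disc_boundary n" for n
      by (auto simp: disc_def open_disc_def disc_boundary_def)
    then have eq: "\<Phi> c ` disc (dm c) = cell dm \<Phi> c \<union> \<Phi> c ` disc_boundary (dm c)" for c
      by (simp add: cell_def image_Un)
    have "\<Phi> c ` disc_boundary (dm c) \<subseteq> (\<Union>c\<in>T. cell dm \<Phi> c)" if "c \<in> T" for c
    proof -
      have "\<Phi> c ` disc_boundary (dm c) \<subseteq> (\<Union>e\<in>{e\<in>K. dm e < dm c}. cell dm \<Phi> e)"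
        using CW T that unfolding finite_CW_complex_def by blast
      then show ?thesis using down[OF that] by blast
    qed
    then show ?thesis unfolding eq by blast
  qed
  finally show ?thesis using T by (simp add: subcomplex_def)
qed

section \<open>The cellular boundary operator\<close>

definition bd_cell ::
  "'c set \<Rightarrow> ('c \<Rightarrow> nat) \<Rightarrow> ('c \<Rightarrow> (nat \<Rightarrow> real) \<Rightarrow> 'a) \<Rightarrow> nat \<Rightarrow> 'c \<Rightarrow> real^'c::finite" where
  "bd_cell K dm \<Phi> k c = (\<chi> e. if e \<in> K \<and> dm e + 1 = k then of_int (incidence dm \<Phi> c e) else 0)"

abbreviation cells_of_dim :: "'c set \<Rightarrow> ('c \<Rightarrow> nat) \<Rightarrow> nat \<Rightarrow> 'c set" where
  "cells_of_dim K dm k \<equiv> {c \<in> K. dm c = k}"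

lemma bd_eq_sum: "bd K dm \<Phi> k x = (\<Sum>c\<in>cells_of_dim K dm k. vec_nth x c *\<^sub>R bd_cell K dm \<Phi> k c)"
  by (auto simp: Finite_Cartesian_Product.vec_eq_iff bd_def bd_cell_def mult.commute intro!: sum.neutral)

lemma bd_cell_Ints: "vec_nth (bd_cell K dm \<Phi> k c) e \<in> \<int>"
  by (simp add: bd_cell_def)

lemma adjoint_bd:
  "adjoint (bd K dm \<Phi> k) y =
     (\<chi> c. if c \<in> K \<and> dm c = k then inner (bd_cell K dm \<Phi> k c) y else 0)" (is "_ = ?g y")
proof -
  have "inner (bd K dm \<Phi> k x) y = inner x (?g y)" for x y
  proof -
    have "inner (bd K dm \<Phi> k x) y =
        (\<Sum>c\<in>cells_of_dim K dm k. vec_nth x c * inner (bd_cell K dm \<Phi> k c) y)"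
      by (simp add: bd_eq_sum inner_sum_left)
    also have "\<dots> = (\<Sum>c\<in>UNIV. vec_nth x c * vec_nth (?g y) c)"
      by (intro sum.mono_neutral_cong_left) auto
    finally show ?thesis by (simp add: inner_vec_def)
  qed
  then show ?thesis by (subst adjoint_unique[of _ ?g]) auto
qed

lemma boundaries_eq_image:
  assumes A: "0 \<in> A"
  shows "boundaries A K dm \<Phi> k =
    {\<Sum>c\<in>cells_of_dim K dm (k + 1). y c *\<^sub>R bd_cell K dm \<Phi> (k + 1) c | y. \<forall>c. y c \<in> A}"
proof (intro equalityI subsetI)
  fix v assume "v \<in> boundaries A K dm \<Phi> k"
  then obtain x where "x \<in> chains A K dm (k + 1)" "v = bd K dm \<Phi> (k + 1) x"
    by (auto simp: boundaries_def)
  then show "v \<in> {\<Sum>c\<in>cells_of_dim K dm (k + 1). y c *\<^sub>R bd_cell K dm \<Phi> (k + 1) c | y. \<forall>c. y c \<in> A}"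
    by (intro CollectI exI[of _ "vec_nth x"]) (auto simp: bd_eq_sum chains_def)
next
  fix v assume "v \<in> {\<Sum>c\<in>cells_of_dim K dm (k + 1). y c *\<^sub>R bd_cell K dm \<Phi> (k + 1) c | y. \<forall>c. y c \<in> A}"
  then obtain y where y: "\<forall>c. y c \<in> A"
    "v = (\<Sum>c\<in>cells_of_dim K dm (k + 1). y c *\<^sub>R bd_cell K dm \<Phi> (k + 1) c)" by auto
  let ?x = "\<chi> c. if c \<in> K \<and> dm c = k + 1 then y c else 0"
  have "?x \<in> chains A K dm (k + 1)" using y A by (auto simp: chains_def)
  moreover have "bd K dm \<Phi> (k + 1) ?x = v" unfolding bd_eq_sum y(2) by (intro sum.cong) auto
  ultimately show "v \<in> boundaries A K dm \<Phi> k" unfolding boundaries_def by blast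
qed

lemma boundaries_Ints:
  "boundaries \<int> K dm \<Phi> k =
    {\<Sum>c\<in>cells_of_dim K dm (k + 1). of_int (m c) *\<^sub>R bd_cell K dm \<Phi> (k + 1) c | m :: 'c::finite \<Rightarrow> int. True}"
  (is "_ = ?R")
proof (intro equalityI subsetI)
  fix v :: "real^'c" assume "v \<in> boundaries \<int> K dm \<Phi> k"
  then obtain y :: "'c \<Rightarrow> real" where y: "\<forall>c. y c \<in> \<int>"
    "v = (\<Sum>c\<in>cells_of_dim K dm (k + 1). y c *\<^sub>R bd_cell K dm \<Phi> (k + 1) c)"
    unfolding boundaries_eq_image[OF Ints_0] by auto
  then show "v \<in> ?R" by (intro CollectI exI[of _ "\<lambda>c. \<lfloor>y c\<rfloor>"]) simp
next
  fix v assume "v \<in> ?R"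
  then obtain m :: "'c \<Rightarrow> int"
    where "v = (\<Sum>c\<in>cells_of_dim K dm (k + 1). of_int (m c) *\<^sub>R bd_cell K dm \<Phi> (k + 1) c)" by auto
  then show "v \<in> boundaries \<int> K dm \<Phi> k"
    unfolding boundaries_eq_image[OF Ints_0] by (intro CollectI exI[of _ "\<lambda>c. of_int (m c)"]) simp
qed

lemma boundaries_UNIV:
  "boundaries UNIV K dm \<Phi> k = span (bd_cell K dm \<Phi> (k + 1) ` cells_of_dim K dm (k + 1))"
proof (intro equalityI subsetI)
  fix v assume "v \<in> boundaries UNIV K dm \<Phi> k"
  then show "v \<in> span (bd_cell K dm \<Phi> (k + 1) ` cells_of_dim K dm (k + 1))"
    unfolding boundaries_eq_image[OF UNIV_I]
    by (elim CollectE exE conjE ssubst) (intro span_sum span_scale span_base imageI)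
next
  have "bd_cell K dm \<Phi> (k + 1) ` cells_of_dim K dm (k + 1) \<subseteq> boundaries UNIV K dm \<Phi> k"
  proof (rule image_subsetI)
    fix c assume c: "c \<in> cells_of_dim K dm (k + 1)"
    have "bd_cell K dm \<Phi> (k + 1) c =
        (\<Sum>e\<in>cells_of_dim K dm (k + 1). (if e = c then 1 else 0) *\<^sub>R bd_cell K dm \<Phi> (k + 1) e)"
      using c by (subst sum.remove[of _ c]) (auto intro!: sum.neutral)
    then show "bd_cell K dm \<Phi> (k + 1) c \<in> boundaries UNIV K dm \<Phi> k"
      unfolding boundaries_eq_image[OF UNIV_I] by (intro CollectI exI[of _ "\<lambda>e. if e = c then 1 else 0"]) simp
  qed
  moreover have "subspace (boundaries UNIV K dm \<Phi> k)"
  proof -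
    have "linear (bd K dm \<Phi> (k + 1))"
      by (rule linearI) (simp_all add: bd_eq_sum algebra_simps sum.distrib scaleR_sum_right)
    moreover have "subspace (chains UNIV K dm (k + 1))"
    proof -
      have "chains UNIV K dm (k + 1) = {x. \<forall>c. \<not> (c \<in> K \<and> dm c = k + 1) \<longrightarrow> vec_nth x c = 0}"
        by (auto simp: chains_def)
      then show ?thesis by (auto simp: subspace_def)
    qed
    ultimately show ?thesis unfolding boundaries_def by (rule linear_subspace_image)
  qed
  ultimately show "v \<in> boundaries UNIV K dm \<Phi> k"
    if "v \<in> span (bd_cell K dm \<Phi> (k + 1) ` cells_of_dim K dm (k + 1))" for v
    using that span_minimal by blast
qed

text \<open>
  For \<open>T = K\<close> this is a formula for the Laplacian itself.
\<close>

lemma tree_laplacian_eq_frame_operator: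
  assumes T: "T \<subseteq> K" and faces: "cells_of_dim K dm k \<subseteq> T"
  shows "tree_laplacian K dm \<Phi> T (k + 1) = frame_operator (bd_cell K dm \<Phi> (k + 1)) (cells_of_dim T dm (k + 1))"
proof
  fix v
  have "bd_cell T dm \<Phi> (k + 1) = bd_cell K dm \<Phi> (k + 1)"
    using T faces by (fastforce simp: bd_cell_def Finite_Cartesian_Product.vec_eq_iff)
  then have "tree_laplacian K dm \<Phi> T (k + 1) v = (\<Sum>c\<in>cells_of_dim K dm (k + 1).
      (if c \<in> T \<and> dm c = k + 1 then inner (bd_cell K dm \<Phi> (k + 1) c) v else 0) *\<^sub>R bd_cell K dm \<Phi> (k + 1) c)"
    by (simp only: tree_laplacian_def o_apply bd_eq_sum adjoint_bd vec_lambda_beta)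
  also have "\<dots> = frame_operator (bd_cell K dm \<Phi> (k + 1)) (cells_of_dim T dm (k + 1)) v"
    unfolding frame_operator_def using T by (intro sum.mono_neutral_cong_right) auto
  finally show "tree_laplacian K dm \<Phi> T (k + 1) v = \<dots>" .
qed


text \<open>Without cells in the next dimension the boundaries vanish, so homology is the group of cycles.\<close>

lemma trivial_cellular_homology_iff:
  fixes T :: "'c::finite set"
  assumes A: "0 \<in> A" and top: "cells_of_dim T dm (k + 1) = {}"
  shows "trivial_group (cellular_homology A T dm \<Phi> k) \<longleftrightarrow> cycles A T dm \<Phi> k = {0}"
proof -
  let ?G = "cycle_group A T dm \<Phi> k"
  have B: "boundaries A T dm \<Phi> k = {0}"
    unfolding boundaries_eq_image[OF A] top using A by auto
  have zero: "0 \<in> cycles A T dm \<Phi> k"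
    using A by (simp add: cycles_def chains_def bd_eq_sum)
  have coset: "r_coset ?G {0} x = {x}" for x
    by (simp add: r_coset_def cycle_group_def)
  have carrier: "carrier (cellular_homology A T dm \<Phi> k) = (\<lambda>x. {x}) ` cycles A T dm \<Phi> k"
    unfolding cellular_homology_def B carrier_FactGroup coset by (simp add: cycle_group_def)
  have one: "one (cellular_homology A T dm \<Phi> k) = {0}"
    by (simp add: cellular_homology_def B)
  show ?thesis
  proof
    assume "trivial_group (cellular_homology A T dm \<Phi> k)"
    then have "(\<lambda>x. {x}) ` cycles A T dm \<Phi> k = {{0}}"
      unfolding trivial_group_def carrier one by simp
    then show "cycles A T dm \<Phi> k = {0}" using zero by blast
  next
    assume Z: "cycles A T dm \<Phi> k = {0}"
    have mult: "monoid.mult (cellular_homology A T dm \<Phi> k) {0} {0} = {0}"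
      by (simp add: cellular_homology_def set_mult_def cycle_group_def)
    have "Group.group (cellular_homology A T dm \<Phi> k)"
      by (rule groupI) (auto simp: carrier Z one mult)
    then show "trivial_group (cellular_homology A T dm \<Phi> k)"
      by (simp add: trivial_group_def carrier one Z)
  qed
qed

lemma integer_cycles_trivial_iff:
  "cycles \<int> T dm \<Phi> k = {0} \<longleftrightarrow>
     inj_on (bd_cell T dm \<Phi> k) (cells_of_dim T dm k) \<and>
     independent (bd_cell T dm \<Phi> k ` cells_of_dim T dm k)" (is "?Z \<longleftrightarrow> _")
proof -
  have fin: "finite (cells_of_dim T dm k)" by simp
  have "?Z \<longleftrightarrow> (\<forall>m :: 'a \<Rightarrow> int. (\<Sum>c\<in>cells_of_dim T dm k. of_int (m c) *\<^sub>R bd_cell T dm \<Phi> k c) = 0 \<longrightarrow>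
      (\<forall>c\<in>cells_of_dim T dm k. m c = 0))" (is "_ \<longleftrightarrow> ?M")
  proof
    assume Z: ?Z
    show ?M
    proof (intro allI impI ballI)
      fix m :: "'a \<Rightarrow> int" and c
      assume m: "(\<Sum>c\<in>cells_of_dim T dm k. of_int (m c) *\<^sub>R bd_cell T dm \<Phi> k c) = 0"
        and c: "c \<in> cells_of_dim T dm k"
      let ?x = "\<chi> c. if c \<in> T \<and> dm c = k then real_of_int (m c) else 0"
      have "bd T dm \<Phi> k ?x = 0"
        unfolding bd_eq_sum by (rule trans[OF sum.cong m]) auto
      then have "?x \<in> cycles \<int> T dm \<Phi> k" by (auto simp: cycles_def chains_def)
      then have "vec_nth ?x c = 0" using Z by simp
      then show "m c = 0" using c by simp
    qed
  next
    assume M: ?M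
    have "x = 0" if x: "x \<in> cycles \<int> T dm \<Phi> k" for x
    proof -
      have int: "vec_nth x c \<in> \<int>" and supp: "c \<notin> cells_of_dim T dm k \<Longrightarrow> vec_nth x c = 0" for c
        using x by (auto simp: cycles_def chains_def)
      have "(\<Sum>c\<in>cells_of_dim T dm k. of_int \<lfloor>vec_nth x c\<rfloor> *\<^sub>R bd_cell T dm \<Phi> k c) = bd T dm \<Phi> k x"
        using int by (simp add: bd_eq_sum of_int_floor)
      then have "\<forall>c\<in>cells_of_dim T dm k. \<lfloor>vec_nth x c\<rfloor> = 0"
        using M[rule_format, of "\<lambda>c. \<lfloor>vec_nth x c\<rfloor>"] x by (simp add: cycles_def)
      then have "vec_nth x c = 0" for c
        using supp[of c] of_int_floor[OF int[of c]] by (cases "c \<in> cells_of_dim T dm k") auto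
      then show "x = 0" by (simp add: Finite_Cartesian_Product.vec_eq_iff)
    qed
    moreover have "0 \<in> cycles \<int> T dm \<Phi> k" by (simp add: cycles_def chains_def bd_eq_sum)
    ultimately show ?Z by blast
  qed
  also have "?M \<longleftrightarrow> inj_on (bd_cell T dm \<Phi> k) (cells_of_dim T dm k) \<and>
      independent (bd_cell T dm \<Phi> k ` cells_of_dim T dm k)"
    by (rule integer_independent_iff[OF fin bd_cell_Ints, symmetric])
  finally show ?thesis .
qed

section \<open>Spanning trees\<close>

lemma cycles_skeleton_cong:
  assumes "skeleton T dm k = skeleton K dm k"
  shows "cycles A T dm \<Phi> k = cycles A K dm \<Phi> k"
proof -
  have eq: "c \<in> T \<longleftrightarrow> c \<in> K" if "dm c \<le> k" for c
    using assms that by (auto simp: skeleton_def set_eq_iff)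
  have "chains A T dm k = chains A K dm k"
    using eq by (auto simp: chains_def)
  moreover have "bd T dm \<Phi> k = bd K dm \<Phi> k"
  proof -
    have "cells_of_dim T dm k = cells_of_dim K dm k" using eq by auto
    moreover have "e \<in> T \<and> dm e + 1 = k \<longleftrightarrow> e \<in> K \<and> dm e + 1 = k" for e using eq[of e] by auto
    ultimately show ?thesis by (auto simp: bd_def fun_eq_iff)
  qed
  ultimately show ?thesis by (simp add: cycles_def)
qed

text \<open>
  The combinatorial description of spanning trees: they correspond to the sets of top-dimensional
  cells whose boundaries form a basis of the space of boundaries.  The equality of Betti numbers
  becomes an equality of dimensions of boundary spaces, because a tree contains the skeleton that
  determines the cycles.
\<close>

lemma spanning_tree_iff:
  fixes K :: "'c::finite set"
  assumes CW: "finite_CW_complex X K dm \<Phi>" and top: "\<forall>c\<in>K. dm c \<le> k + 1"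
  shows "spanning_tree X K dm \<Phi> (k + 1) T \<longleftrightarrow>
    (\<exists>S \<subseteq> cells_of_dim K dm (k + 1). T = skeleton K dm k \<union> S \<and>
       card S = dim (boundaries UNIV K dm \<Phi> k) \<and>
       inj_on (bd_cell K dm \<Phi> (k + 1)) S \<and> independent (bd_cell K dm \<Phi> (k + 1) ` S))"
    (is "_ \<longleftrightarrow> (\<exists>S \<subseteq> ?C. ?Q S)")
proof -
  let ?u = "bd_cell K dm \<Phi> (k + 1)"
  have *: "spanning_tree X K dm \<Phi> (k + 1) T \<longleftrightarrow> card S = dim (boundaries UNIV K dm \<Phi> k) \<and>
       inj_on ?u S \<and> independent (?u ` S)"
    if S: "S \<subseteq> ?C" and T: "T = skeleton K dm k \<union> S" for S
  proof -
    have TK: "T \<subseteq> K" and sk: "skeleton K dm k \<subseteq> T" using S T by (auto simp: skeleton_def)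
    have cells: "cells_of_dim T dm (k + 1) = S" using S T by (auto simp: skeleton_def)
    have none: "cells_of_dim T dm (k + 1 + 1) = {}" using TK top by fastforce
    have sk_eq: "skeleton T dm k = skeleton K dm k" using TK sk by (auto simp: skeleton_def)
    then have "bd_cell T dm \<Phi> (k + 1) = ?u"
      by (auto simp: bd_cell_def Finite_Cartesian_Product.vec_eq_iff fun_eq_iff skeleton_def set_eq_iff)
    then have bT: "boundaries UNIV T dm \<Phi> k = span (?u ` S)"
      and hom: "trivial_group (cellular_homology \<int> T dm \<Phi> (k + 1)) \<longleftrightarrow> inj_on ?u S \<and> independent (?u ` S)"
      using trivial_cellular_homology_iff[OF Ints_0 none, of \<Phi>] integer_cycles_trivial_iff[of T dm \<Phi> "k + 1"]
      by (simp_all only: boundaries_UNIV cells)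
    have sub: "subcomplex X K dm \<Phi> T"
    proof (rule subcomplexI[OF CW TK])
      fix c e assume c: "c \<in> T" and e: "e \<in> K" "dm e < dm c"
      have "dm c \<le> k + 1" using top TK c by blast
      then have "e \<in> skeleton K dm k" using e by (simp add: skeleton_def)
      then show "e \<in> T" using sk by blast
    qed
    have "spanning_tree X K dm \<Phi> (k + 1) T \<longleftrightarrow>
        (inj_on ?u S \<and> independent (?u ` S)) \<and> betti T dm \<Phi> k = betti K dm \<Phi> k"
      using sub sk unfolding spanning_tree_def hom add_diff_cancel_right' by blast
    moreover have "betti T dm \<Phi> k = betti K dm \<Phi> k \<longleftrightarrow>
        dim (boundaries UNIV T dm \<Phi> k) = dim (boundaries UNIV K dm \<Phi> k)"
      unfolding betti_def cycles_skeleton_cong[OF sk_eq] by auto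
    moreover have "dim (boundaries UNIV T dm \<Phi> k) = card S" if "inj_on ?u S" "independent (?u ` S)"
      unfolding bT using that by (simp add: dim_eq_card_independent card_image)
    ultimately show ?thesis by metis
  qed
  show ?thesis
  proof
    assume tree: "spanning_tree X K dm \<Phi> (k + 1) T"
    then have "T \<subseteq> K" "skeleton K dm k \<subseteq> T"
      by (auto simp: spanning_tree_def subcomplex_def)
    then have "cells_of_dim T dm (k + 1) \<subseteq> ?C" "T = skeleton K dm k \<union> cells_of_dim T dm (k + 1)"
      using top by (auto simp: skeleton_def le_Suc_eq)
    then show "\<exists>S \<subseteq> ?C. ?Q S" using *[of "cells_of_dim T dm (k + 1)"] tree by blast
  next
    assume "\<exists>S \<subseteq> ?C. ?Q S"
    then show "spanning_tree X K dm \<Phi> (k + 1) T" using * by blast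
  qed
qed

text \<open>
  The boundaries of the cells of \<open>S\<close> span a subspace of the full dimension, so the tree has the
  same real boundaries as the whole complex, and both tree and complex are compared inside one
  space.
\<close>

lemma boundary_basis_tree:
  fixes K :: "'c::finite set"
  assumes S: "S \<subseteq> cells_of_dim K dm (k + 1)" "card S = dim (boundaries UNIV K dm \<Phi> k)"
      "inj_on (bd_cell K dm \<Phi> (k + 1)) S" "independent (bd_cell K dm \<Phi> (k + 1) ` S)"
    and T: "T = skeleton K dm k \<union> S"
  shows "boundaries UNIV T dm \<Phi> k = boundaries UNIV K dm \<Phi> k"
    and "tree_laplacian K dm \<Phi> T (k + 1) = frame_operator (bd_cell K dm \<Phi> (k + 1)) S"
    and "bij_betw (tree_laplacian K dm \<Phi> T (k + 1)) (boundaries UNIV T dm \<Phi> k) (boundaries UNIV T dm \<Phi> k)"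
    and "det_on (boundaries UNIV T dm \<Phi> k) (tree_laplacian K dm \<Phi> T (k + 1)) = tree_weight T dm \<Phi> (k + 1)"
proof -
  let ?u = "bd_cell K dm \<Phi> (k + 1)"
  have cells: "cells_of_dim T dm (k + 1) = S" using S(1) T by (auto simp: skeleton_def)
  have u: "bd_cell T dm \<Phi> (k + 1) = ?u"
    using S(1) T by (auto simp: bd_cell_def Finite_Cartesian_Product.vec_eq_iff fun_eq_iff skeleton_def)
  have bT: "boundaries UNIV T dm \<Phi> k = span (?u ` S)"
    unfolding boundaries_UNIV u cells ..
  have "span (?u ` S) = boundaries UNIV K dm \<Phi> k"
  proof (rule subspace_dim_equal)
    show "span (?u ` S) \<subseteq> boundaries UNIV K dm \<Phi> k"
      unfolding boundaries_UNIV using S(1) by (intro span_mono image_mono)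
    show "dim (boundaries UNIV K dm \<Phi> k) \<le> dim (span (?u ` S))"
      using S(2-4) by (simp add: dim_eq_card_independent card_image)
  qed (simp_all add: boundaries_UNIV)
  then show bTK: "boundaries UNIV T dm \<Phi> k = boundaries UNIV K dm \<Phi> k" using bT by simp
  have "T \<subseteq> K" "cells_of_dim K dm k \<subseteq> T" using S(1) T by (auto simp: skeleton_def)
  from tree_laplacian_eq_frame_operator[OF this]
  show L: "tree_laplacian K dm \<Phi> T (k + 1) = frame_operator ?u S" unfolding cells .
  show "bij_betw (tree_laplacian K dm \<Phi> T (k + 1)) (boundaries UNIV T dm \<Phi> k) (boundaries UNIV T dm \<Phi> k)"
    unfolding L bT by (rule bij_betw_frame_operator) simp_all
  have "boundaries \<int> T dm \<Phi> k = {\<Sum>c\<in>S. of_int (m c) *\<^sub>R ?u c | m :: 'c \<Rightarrow> int. True}"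
    unfolding boundaries_Ints u cells ..
  then show "det_on (boundaries UNIV T dm \<Phi> k) (tree_laplacian K dm \<Phi> T (k + 1)) = tree_weight T dm \<Phi> (k + 1)"
    unfolding L tree_weight_def using det_frame_operator_covolume[of S ?u, OF _ S(3,4) bT[symmetric]] by simp
qed

theorem mainTheorem5:
  fixes X :: "'a topology" and K :: "('c::finite) set" and dm :: "'c \<Rightarrow> nat"
    and \<Phi> :: "'c \<Rightarrow> (nat \<Rightarrow> real) \<Rightarrow> 'a" and d :: nat
  assumes "finite_CW_complex X K dm \<Phi>"
    and "connected_space X"
    and "CW_dimension K dm d"
    and "d \<ge> 1"
  shows "(\<forall>T. spanning_tree X K dm \<Phi> d T \<longrightarrow>
            bij_betw (tree_laplacian K dm \<Phi> T d)
              (boundaries UNIV T dm \<Phi> (d - 1)) (boundaries UNIV T dm \<Phi> (d - 1))) \<and>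
         det_on (boundaries UNIV K dm \<Phi> (d - 1)) (laplacian K dm \<Phi> d) =
           (\<Sum>T | spanning_tree X K dm \<Phi> d T.
              det_on (boundaries UNIV T dm \<Phi> (d - 1)) (tree_laplacian K dm \<Phi> T d)) \<and>
         (\<Sum>T | spanning_tree X K dm \<Phi> d T.
              det_on (boundaries UNIV T dm \<Phi> (d - 1)) (tree_laplacian K dm \<Phi> T d)) =
           (\<Sum>T | spanning_tree X K dm \<Phi> d T. tree_weight T dm \<Phi> d)"
proof -
  obtain k where d: "d = k + 1" using assms(4) by (metis add.commute le_Suc_ex)
  have k: "d - 1 = k" using d by simp
  note CW = assms(1)
  have top: "\<forall>c\<in>K. dm c \<le> k + 1"
    using assms(3) d by (auto simp: CW_dimension_def)
  define V :: "(real^'c) set" where "V = boundaries UNIV K dm \<Phi> k"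
  define u where "u = bd_cell K dm \<Phi> (k + 1)"
  define C where "C = cells_of_dim K dm (k + 1)"
  define \<B> where "\<B> = {S. S \<subseteq> C \<and> card S = dim V \<and> inj_on u S \<and> independent (u ` S)}"
  let ?tree = "\<lambda>S. skeleton K dm k \<union> S"
  have trees: "{T. spanning_tree X K dm \<Phi> d T} = ?tree ` \<B>"
    unfolding d spanning_tree_iff[OF CW top] \<B>_def V_def u_def C_def by auto
  have inj: "inj_on ?tree \<B>"
  proof (rule inj_onI)
    have "C \<inter> ?tree S = S" if "S \<in> \<B>" for S
      using that by (auto simp: \<B>_def C_def skeleton_def)
    moreover fix S S' assume "S \<in> \<B>" "S' \<in> \<B>" "?tree S = ?tree S'"
    ultimately show "S = S'" by metis
  qed
  have tree_props: "boundaries UNIV (?tree S) dm \<Phi> k = V"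
    "tree_laplacian K dm \<Phi> (?tree S) (k + 1) = frame_operator u S"
    "bij_betw (tree_laplacian K dm \<Phi> (?tree S) (k + 1))
       (boundaries UNIV (?tree S) dm \<Phi> k) (boundaries UNIV (?tree S) dm \<Phi> k)"
    "det_on (boundaries UNIV (?tree S) dm \<Phi> k) (tree_laplacian K dm \<Phi> (?tree S) (k + 1)) =
       tree_weight (?tree S) dm \<Phi> (k + 1)" if "S \<in> \<B>" for S
    using that boundary_basis_tree[of S K dm k \<Phi> "?tree S"]
    unfolding \<B>_def V_def u_def C_def by auto
  have V: "subspace V" "u ` C \<subseteq> V"
    unfolding V_def u_def C_def boundaries_UNIV by (auto intro: span_base)
  have "tree_laplacian K dm \<Phi> K (k + 1) = frame_operator u C"
    unfolding u_def C_def by (rule tree_laplacian_eq_frame_operator) auto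
  then have "laplacian K dm \<Phi> (k + 1) = frame_operator u C"
    by (simp add: laplacian_def tree_laplacian_def)
  then have "det_on V (laplacian K dm \<Phi> (k + 1)) =
      (\<Sum>S | S \<subseteq> C \<and> card S = dim V. det_on V (frame_operator u S))"
    using det_frame_operator_sum[OF V] by simp
  also have "\<dots> = (\<Sum>S\<in>\<B>. det_on V (frame_operator u S))"
  proof (intro sum.mono_neutral_right ballI)
    fix S assume "S \<in> {S. S \<subseteq> C \<and> card S = dim V} - \<B>"
    then show "det_on V (frame_operator u S) = 0"
      using V by (intro det_frame_operator_dependent) (auto simp: \<B>_def)
  qed (auto simp: \<B>_def)
  also have "\<dots> = (\<Sum>S\<in>\<B>. det_on (boundaries UNIV (?tree S) dm \<Phi> k) (tree_laplacian K dm \<Phi> (?tree S) (k + 1)))"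
    using tree_props(1,2) by (intro sum.cong) auto
  also have "\<dots> = (\<Sum>T | spanning_tree X K dm \<Phi> d T.
      det_on (boundaries UNIV T dm \<Phi> k) (tree_laplacian K dm \<Phi> T d))"
    unfolding trees by (simp add: sum.reindex[OF inj] d)
  finally have det: "det_on (boundaries UNIV K dm \<Phi> k) (laplacian K dm \<Phi> d) = \<dots>"
    by (simp only: V_def d)
  have tree_of: "\<exists>S\<in>\<B>. T = ?tree S" if "spanning_tree X K dm \<Phi> d T" for T
    using that trees by blast
  show ?thesis
    unfolding k
  proof (intro conjI allI impI sum.cong refl)
    fix T assume "spanning_tree X K dm \<Phi> d T"
    then obtain S where "S \<in> \<B>" "T = ?tree S" using tree_of by blast
    then show "bij_betw (tree_laplacian K dm \<Phi> T d) (boundaries UNIV T dm \<Phi> k) (boundaries UNIV T dm \<Phi> k)"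
      unfolding d by (simp only: tree_props(3))
  next
    fix T assume "T \<in> {T. spanning_tree X K dm \<Phi> d T}"
    then obtain S where "S \<in> \<B>" "T = ?tree S" using tree_of by blast
    then show "det_on (boundaries UNIV T dm \<Phi> k) (tree_laplacian K dm \<Phi> T d) = tree_weight T dm \<Phi> d"
      unfolding d by (simp only: tree_props(4))
  qed (use det in \<open>simp only:\<close>)
qed

end
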